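(* Let $n\ge 1$ and let $\phi,\psi\in M_n(L^\infty)$. Assume that $P(\overline z\,\psi(z))$ and $P(\overline z\,\psi^*(z))$ are regular. Then $T_\phi T_\psi=T_\psi T_\phi^*$ on $H^2_n$ if and only if there exists $A\in M_n(\mathbb{C})$ such that the following hold: (i) $\phi(z)-\psi(z)A$ is co-analytic; (ii) $\phi(z)-\psi^*(z)A^*$ is co-analytic; (iii) $\phi(z)\psi(z)=\psi(z)\phi^*(z)$.
   Context: $L^2,L^\infty$ are the square-integrable and essentially bounded functions on the unit circle $\mathbb{T}$ (normalized Lebesgue measure); $H^2\subset L^2$ is the closed subspace of functions whose negative Fourier coefficients vanish. $M_n(L^\infty)$ is the set of $n\times n$ matrices with entries in $L^\infty$, regarded as matrix-valued functions on $\mathbb{T}$. $H^2_n=\bigoplus_1^n H^2$ is the $\mathbb{C}^n$-valued Hardy space. $P$ denotes the orthogonal projection of $L^2$ onto $H^2$, applied entrywise to vector- and matrix-valued functions. For $F\in M_n(L^\infty)$, the Toeplitz operator $T_F:H^2_n\to H^2_n$ is $T_F(h)(z)=P(F(z)h(z))$. $F^*$ is the pointwise adjoint of $F$. A matrix-valued function on $\mathbb{T}$ is co-analytic (conjugate analytic) if all its Fourier coefficients of positive index vanish (equivalently, its pointwise adjoint has vanishing Fourier coefficients of negative index). An $m\times m$ matrix-valued function with entries in $L^2$ is called regular if its $m$ column vectors are linearly independent in $L^2_m$, the space of $\mathbb{C}^m$-valued $L^2$ functions. Equalities of functions on $\mathbb{T}$ are almost everywhere. *)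

theory Defs
  imports "HOL-Analysis.Analysis"
begin

definition circle_measure :: "complex measure" where
  "circle_measure =
     distr (uniform_measure lborel {0..<2 * pi}) (restrict_space borel (sphere 0 1)) cis"

text \<open>
  Elements of the function spaces are represented by Borel functions; equality in these spaces
  is equality almost everywhere with respect to \<^const>\<open>circle_measure\<close>.
\<close>

definition L2 :: "(complex \<Rightarrow> complex) set" where
  "L2 = {f \<in> borel_measurable circle_measure. integrable circle_measure (\<lambda>z. (norm (f z))\<^sup>2)}"

definition Linfty :: "(complex \<Rightarrow> complex) set" where
  "Linfty = {f \<in> borel_measurable circle_measure. \<exists>B::real. AE z in circle_measure. norm (f z) \<le> B}"

definition fourier_coeff :: "(complex \<Rightarrow> complex) \<Rightarrow> int \<Rightarrow> complex" where
  "fourier_coeff f k = (LINT z|circle_measure. f z * z powi (- k))"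

definition H2 :: "(complex \<Rightarrow> complex) set" where
  "H2 = {f \<in> L2. \<forall>k<0. fourier_coeff f k = 0}"

definition L2_inner :: "(complex \<Rightarrow> complex) \<Rightarrow> (complex \<Rightarrow> complex) \<Rightarrow> complex" where
  "L2_inner f g = (LINT z|circle_measure. f z * cnj (g z))"

text \<open>
  The orthogonal projection of \<open>L\<^sup>2\<close> onto \<open>H\<^sup>2\<close>. The defining property determines the value
  up to almost everywhere equality, and a representative is chosen.
\<close>

definition riesz_proj :: "(complex \<Rightarrow> complex) \<Rightarrow> complex \<Rightarrow> complex" where
  "riesz_proj f = (SOME g. g \<in> H2 \<and> (\<forall>h\<in>H2. L2_inner (\<lambda>z. f z - g z) h = 0))"

definition H2_vec :: "(complex \<Rightarrow> complex ^ 'n) set" where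
  "H2_vec = {h. \<forall>i. (\<lambda>z. h z $ i) \<in> H2}"

definition H2_vec_inner :: "(complex \<Rightarrow> complex ^ 'n) \<Rightarrow> (complex \<Rightarrow> complex ^ 'n) \<Rightarrow> complex" where
  "H2_vec_inner f g = (\<Sum>i\<in>UNIV. L2_inner (\<lambda>z. f z $ i) (\<lambda>z. g z $ i))"

definition L2_mat :: "(complex \<Rightarrow> complex ^ 'n ^ 'n) set" where
  "L2_mat = {F. \<forall>i j. (\<lambda>z. F z $ i $ j) \<in> L2}"

definition Linfty_mat :: "(complex \<Rightarrow> complex ^ 'n ^ 'n) set" where
  "Linfty_mat = {F. \<forall>i j. (\<lambda>z. F z $ i $ j) \<in> Linfty}"

definition proj_vec :: "(complex \<Rightarrow> complex ^ 'n) \<Rightarrow> complex \<Rightarrow> complex ^ 'n" where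
  "proj_vec h z = (\<chi> i. riesz_proj (\<lambda>w. h w $ i) z)"

definition proj_mat :: "(complex \<Rightarrow> complex ^ 'n ^ 'n) \<Rightarrow> complex \<Rightarrow> complex ^ 'n ^ 'n" where
  "proj_mat F z = (\<chi> i j. riesz_proj (\<lambda>w. F w $ i $ j) z)"

definition toeplitz ::
    "(complex \<Rightarrow> complex ^ 'n ^ 'n) \<Rightarrow> (complex \<Rightarrow> complex ^ 'n) \<Rightarrow> complex \<Rightarrow> complex ^ 'n" where
  "toeplitz F h = proj_vec (\<lambda>z. F z *v h z)"

text \<open>
  The Hilbert space adjoint of a bounded operator on \<open>H\<^sup>2\<^sub>n\<close>; as for the projection, the value is
  determined up to almost everywhere equality and a representative is chosen.
\<close>

definition op_adjoint ::
    "((complex \<Rightarrow> complex ^ 'n) \<Rightarrow> complex \<Rightarrow> complex ^ 'n) \<Rightarrow>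
     (complex \<Rightarrow> complex ^ 'n) \<Rightarrow> complex \<Rightarrow> complex ^ 'n" where
  "op_adjoint T h =
     (SOME g. g \<in> H2_vec \<and> (\<forall>k\<in>H2_vec. H2_vec_inner (T k) h = H2_vec_inner k g))"

definition H2_op_eq ::
    "((complex \<Rightarrow> complex ^ 'n) \<Rightarrow> complex \<Rightarrow> complex ^ 'n) \<Rightarrow>
     ((complex \<Rightarrow> complex ^ 'n) \<Rightarrow> complex \<Rightarrow> complex ^ 'n) \<Rightarrow> bool" where
  "H2_op_eq S T \<longleftrightarrow> (\<forall>h\<in>H2_vec. AE z in circle_measure. S h z = T h z)"

definition ctransp :: "complex ^ 'n ^ 'n \<Rightarrow> complex ^ 'n ^ 'n" where
  "ctransp A = transpose (map_matrix cnj A)"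

text \<open>
  Fourier coefficients are only meaningful for integrable entries, hence the first conjunct
  (the Bochner integral of a non-integrable function is \<open>0\<close>).
\<close>

definition coanalytic :: "(complex \<Rightarrow> complex ^ 'n ^ 'n) \<Rightarrow> bool" where
  "coanalytic F \<longleftrightarrow>
     (\<forall>i j. integrable circle_measure (\<lambda>z. F z $ i $ j) \<and>
            (\<forall>k>0. fourier_coeff (\<lambda>z. F z $ i $ j) k = 0))"

definition regular :: "(complex \<Rightarrow> complex ^ 'n ^ 'n) \<Rightarrow> bool" where
  "regular F \<longleftrightarrow>
     F \<in> L2_mat \<and>
     (\<forall>c :: 'n \<Rightarrow> complex.
        (AE z in circle_measure. (\<Sum>j\<in>UNIV. c j *s column j (F z)) = 0) \<longrightarrow> (\<forall>j. c j = 0))"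

end

theory Submission
  imports Defs "HOL-Probability.Probability_Measure"
begin

text \<open>
  Write \<open>\<phi>\<^sub>k\<close>, \<open>\<psi>\<^sub>k\<close> for the matrix Fourier coefficients, \<open>P\<close> for the projection onto \<open>H\<^sup>2\<close> and
  \<open>Q = I - P\<close>. Then \<open>T\<^sub>\<phi> T\<^sub>\<psi> h = P(\<phi> \<psi> h) - P(\<phi> Q(\<psi> h))\<close>, and comparing this identity for \<open>h\<close> and
  \<open>z h\<close> turns \<open>T\<^sub>\<phi> T\<^sub>\<psi> = T\<^sub>\<psi> T\<^sub>\<phi>\<^sup>*\<close> into \<open>\<phi>\<^sub>i \<psi>\<^sub>-\<^sub>j = \<psi>\<^sub>i \<phi>\<^sub>j\<^sup>*\<close> for \<open>i, j \<ge> 1\<close>. Regularity says that the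
  \<open>\<psi>\<^sub>i\<close> have no common kernel and the ranges of the \<open>\<psi>\<^sub>-\<^sub>j\<close> span; hence some \<open>A\<close> satisfies \<open>\<phi>\<^sub>i = \<psi>\<^sub>i A\<close> and
  \<open>\<phi>\<^sub>j\<^sup>* = A \<psi>\<^sub>-\<^sub>j\<close>, which is (i) and (ii). Conversely, under (i) and (ii), both \<open>P(\<phi> Q(\<psi> h))\<close> and
  \<open>P(\<psi> Q(\<phi>\<^sup>* h))\<close> equal \<open>P(\<psi> A Q(\<psi> h))\<close>, so the operator identity reduces to
  \<open>P(\<phi> \<psi> h) = P(\<psi> \<phi>\<^sup>* h)\<close> for all \<open>h\<close>, that is, to (iii).
\<close>

section \<open>Normalized Lebesgue measure on the circle\<close>


lemma measurable_cis_circle: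
  "cis \<in> measurable (uniform_measure lborel {0..<2 * pi}) (restrict_space borel (sphere 0 1))"
proof (rule measurable_restrict_space2)
  have "cis \<in> borel_measurable borel"
    by (intro borel_measurable_continuous_onI continuous_intros)
  then show "cis \<in> borel_measurable (uniform_measure lborel {0..<2 * pi})"
    by simp
qed auto

lemma space_circle_measure [simp]: "space circle_measure = sphere 0 1"
  by (simp add: circle_measure_def space_restrict_space)

lemma sets_circle_measure [measurable_cong]:
  "sets circle_measure = sets (restrict_space borel (sphere 0 1))"
  by (simp add: circle_measure_def)

interpretation circle: prob_space circle_measure
  unfolding circle_measure_def
  by (intro prob_space.prob_space_distr prob_space_uniform_measure measurable_cis_circle) simp_all

lemma borel_measurable_circleI:
  "f \<in> borel_measurable borel \<Longrightarrow> f \<in> borel_measurable circle_measure"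
  using measurable_restrict_space1 measurable_cong_sets[OF sets_circle_measure refl] by blast

lemma power_int_cis: "cis t powi k = cis (of_int k * t)"
  by (cases k rule: int_cases2) (auto simp: Complex.DeMoivre power_int_minus)

text \<open>Change of variables along \<open>cis\<close>, with the uniform measure unfolded as the
  density \<open>1 / (2*pi)\<close> on the interval. Integrals over the circle thus become integrals
  that a primitive can evaluate.\<close>

lemma integral_circle_measure:
  fixes f :: "complex \<Rightarrow> complex"
  assumes [measurable]: "f \<in> borel_measurable circle_measure"
  shows "(LINT z|circle_measure. f z) = (LINT t:{0..<2*pi}|lborel. f (cis t)) / (2 * pi)"
proof -
  have [measurable]: "(\<lambda>t. f (cis t)) \<in> borel_measurable lborel"
    using measurable_compose[OF measurable_cis_circle, of f borel] assms
    by (simp add: measurable_cong_sets[OF sets_circle_measure refl])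
  have "(LINT z|circle_measure. f z) = (LINT t|uniform_measure lborel {0..<2*pi}. f (cis t))"
    unfolding circle_measure_def using assms
    by (intro integral_distr measurable_cis_circle)
       (simp add: measurable_cong_sets[OF sets_circle_measure refl])
  also have "\<dots> = (LINT t|lborel. (indicator {0..<2*pi} t / (2*pi)) *\<^sub>R f (cis t))"
    unfolding uniform_measure_def
    by (subst integral_density[symmetric])
        (auto simp: indicator_def divide_ennreal[of 1, simplified]
            intro!: arg_cong2[where f=lebesgue_integral] density_cong)
  also have "\<dots> = (LINT t|lborel. indicator {0..<2*pi} t *\<^sub>R f (cis t)) / (2*pi)"
    by (subst Bochner_Integration.integral_divide_zero[symmetric]) (simp add: scaleR_conv_of_real)
  finally show ?thesis by (simp add: set_lebesgue_integral_def)
qed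

lemma measurable_power_int_circle [measurable]:
  "(\<lambda>z. z powi k) \<in> borel_measurable circle_measure"
  by (rule borel_measurable_circleI) (cases "k \<ge> 0"; simp add: power_int_def)

text \<open>Orthonormality of the powers of \<open>z\<close>: for \<open>k \<noteq> 0\<close> a
  primitive of \<open>cis (of_int k * t)\<close> takes equal values at 0 and
  \<open>2*pi\<close>.\<close>

lemma integral_circle_power_int:
  "(LINT z|circle_measure. z powi k) = (if k = 0 then 1 else 0)"
proof (cases "k = 0")
  case True then show ?thesis using circle.prob_space by simp
next
  case False
  have [measurable]: "(\<lambda>t. cis (of_int k * t)) \<in> borel_measurable borel"
    by (intro borel_measurable_continuous_onI continuous_intros)
  \<comment> \<open>Adding the null end point \<open>2*pi\<close> gives the closed interval on which
    the fundamental theorem of calculus is stated.\<close>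
  have "(LINT t:{0..<2*pi}|lborel. cis (of_int k * t)) = (LINT t:{0..2*pi}|lborel. cis (of_int k * t))"
    unfolding set_lebesgue_integral_def
    using AE_lborel_singleton[of "2*pi"]
    by (intro integral_cong_AE) (auto simp: indicator_def elim: eventually_mono)
  also have "\<dots> = cis (of_int k * (2*pi)) / (\<i> * of_int k) - cis (of_int k * 0) / (\<i> * of_int k)"
    unfolding set_lebesgue_integral_def using False
  proof (intro integral_FTC_Icc continuous_intros)
    fix t :: real
    have "((\<lambda>z. exp (\<i> * of_int k * z) / (\<i> * of_int k)) has_field_derivative
        exp (\<i> * of_int k * of_real t)) (at (of_real t))"
      using False by (auto intro!: derivative_eq_intros)
    then have "((\<lambda>t. exp (\<i> * of_int k * of_real t) / (\<i> * of_int k)) has_vector_derivative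
        exp (\<i> * of_int k * of_real t)) (at t within {0..2*pi})"
      by (rule has_vector_derivative_real_field)
    then show "((\<lambda>t. cis (of_int k * t) / (\<i> * of_int k)) has_vector_derivative
        cis (of_int k * t)) (at t within {0..2*pi})"
      by (simp add: cis_conv_exp mult_ac)
  qed auto
  also have "\<dots> = 0" using cis_multiple_2pi[of "of_int k"] by (simp add: mult.commute)
  finally show ?thesis using False by (simp add: integral_circle_measure power_int_cis)
qed

section \<open>Fourier coefficients and their uniqueness\<close>


lemma fourier_coeff_cong:
  assumes "\<And>z. norm z = 1 \<Longrightarrow> f z = g z"
  shows "fourier_coeff f k = fourier_coeff g k"
  unfolding fourier_coeff_def by (intro Bochner_Integration.integral_cong) (simp_all add: assms)

lemma fourier_coeff_cong_AE:
  assumes [measurable]: "f \<in> borel_measurable circle_measure" "g \<in> borel_measurable circle_measure"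
    and "AE z in circle_measure. f z = g z"
  shows "fourier_coeff f k = fourier_coeff g k"
  unfolding fourier_coeff_def by (intro integral_cong_AE) (use assms(3) in auto)

lemma integrable_mult_bounded:
  fixes f g :: "'a \<Rightarrow> complex"
  assumes "integrable M f" "g \<in> borel_measurable M" "AE z in M. norm (g z) \<le> B"
  shows "integrable M (\<lambda>z. g z * f z)"
proof (rule Bochner_Integration.integrable_bound)
  show "integrable M (\<lambda>z. B * norm (f z))" using assms(1) by simp
  show "AE z in M. norm (g z * f z) \<le> norm (B * norm (f z))"
    using assms(3)
  proof eventually_elim
    case (elim z)
    then have "norm (g z) * norm (f z) \<le> \<bar>B\<bar> * norm (f z)" by (intro mult_right_mono) auto
    then show ?case by (simp add: norm_mult abs_mult)
  qed
qed (use assms in auto)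

lemma integrable_power_int_mult:
  assumes "integrable circle_measure f"
  shows "integrable circle_measure (\<lambda>z. z powi k * f z)"
  by (rule integrable_mult_bounded[where B=1]) (auto intro!: AE_I2 simp: assms norm_power_int)

lemma integrable_mult_power_int:
  assumes "integrable circle_measure f"
  shows "integrable circle_measure (\<lambda>z. f z * z powi k)"
  using integrable_power_int_mult[OF assms] by (simp add: mult.commute)

lemma fourier_coeff_add:
  assumes "integrable circle_measure f" "integrable circle_measure g"
  shows "fourier_coeff (\<lambda>z. f z + g z) k = fourier_coeff f k + fourier_coeff g k"
  unfolding fourier_coeff_def using assms
  by (simp add: distrib_right Bochner_Integration.integral_add integrable_mult_power_int)

lemma fourier_coeff_diff:
  assumes "integrable circle_measure f" "integrable circle_measure g"
  shows "fourier_coeff (\<lambda>z. f z - g z) k = fourier_coeff f k - fourier_coeff g k"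
  unfolding fourier_coeff_def using assms
  by (simp add: left_diff_distrib Bochner_Integration.integral_diff integrable_mult_power_int)

lemma fourier_coeff_sum:
  assumes "\<And>i. i \<in> I \<Longrightarrow> integrable circle_measure (f i)"
  shows "fourier_coeff (\<lambda>z. \<Sum>i\<in>I. f i z) k = (\<Sum>i\<in>I. fourier_coeff (f i) k)"
  unfolding fourier_coeff_def using assms
  by (simp add: sum_distrib_right Bochner_Integration.integral_sum integrable_mult_power_int)

lemma fourier_coeff_cmult: "fourier_coeff (\<lambda>z. c * f z) k = c * fourier_coeff f k"
  unfolding fourier_coeff_def by (simp add: mult.assoc)

lemma fourier_coeff_mult_const: "fourier_coeff (\<lambda>z. f z * c) k = fourier_coeff f k * c"
  using fourier_coeff_cmult[of c f k] by (simp add: mult.commute)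

lemma fourier_coeff_shift: "fourier_coeff (\<lambda>z. z powi m * f z) k = fourier_coeff f (k - m)"
  unfolding fourier_coeff_def
proof (intro Bochner_Integration.integral_cong refl)
  fix z :: complex assume "z \<in> space circle_measure"
  \<comment> \<open>Exponents of \<open>powi\<close> add up only away from 0, and the circle avoids
    0.\<close>
  then have "z \<noteq> 0" by auto
  then have "z powi (- (k - m)) = z powi m * z powi (- k)" by (simp add: flip: power_int_add)
  then show "z powi m * f z * z powi (- k) = f z * z powi (- (k - m))" by simp
qed

lemma fourier_coeff_power_int: "fourier_coeff (\<lambda>z. z powi m) k = (if k = m then 1 else 0)"
  using fourier_coeff_shift[of m "\<lambda>_. 1" k] integral_circle_power_int[of "m - k"]
  by (simp add: fourier_coeff_def)

lemma cnj_circle: "norm z = 1 \<Longrightarrow> cnj z = z powi -1"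
  using complex_norm_square[of z] by (simp add: power_int_minus inverse_unique)

lemma cnj_power_int_circle: "norm z = 1 \<Longrightarrow> cnj (z powi k) = z powi (- k)"
proof -
  assume *: "norm z = 1"
  have "cnj (z powi k) = (cnj z) powi k" by (cases k rule: int_cases2) (auto simp: power_int_minus)
  also have "\<dots> = z powi (- k)" using cnj_circle[OF *] by (simp add: power_int_minus power_int_inverse)
  finally show ?thesis .
qed

lemma fourier_coeff_cnj: "fourier_coeff (\<lambda>z. cnj (f z)) k = cnj (fourier_coeff f (- k))"
  unfolding fourier_coeff_def Bochner_Integration.integral_cnj[symmetric]
  by (intro Bochner_Integration.integral_cong)
      (auto simp: cnj_power_int_circle simp del: complex_cnj_power_int)

text \<open>Multiplication by a linear function combines shifts of the coefficient sequence by one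
  place, so a zero sequence stays zero; sums and products follow by induction. Together with
  Stone-Weierstrass this gives uniqueness.\<close>

lemma fourier_coeff_real_polynomial_zero:
  assumes "real_polynomial_function p"
    and "integrable circle_measure f" "\<And>k. fourier_coeff f k = 0"
  shows "integrable circle_measure (\<lambda>z. of_real (p z) * f z)
         \<and> (\<forall>k. fourier_coeff (\<lambda>z. of_real (p z) * f z) k = 0)"
  using assms
proof (induction p arbitrary: f rule: real_polynomial_function.induct)
  case (linear p)
  \<comment> \<open>A real-linear function of \<open>z\<close> has the form
    \<open>\<alpha> * z + \<beta> * cnj z\<close>, and on the circle \<open>cnj z\<close> is the
    inverse of \<open>z\<close>.\<close>
  define \<alpha> where "\<alpha> = (of_real (p 1) - \<i> * of_real (p \<i>)) / 2"
  define \<beta> where "\<beta> = (of_real (p 1) + \<i> * of_real (p \<i>)) / 2"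
  have p: "of_real (p z) * f z = \<alpha> * (z powi 1 * f z) + \<beta> * (z powi -1 * f z)" if "norm z = 1" for z
  proof -
    interpret bounded_linear p by fact
    have "p z = p (Re z *\<^sub>R 1 + Im z *\<^sub>R \<i>)"
      by (rule arg_cong[of _ _ p]) (simp add: complex_eq_iff)
    also have "\<dots> = Re z * p 1 + Im z * p \<i>" by (simp only: add scaleR real_scaleR_def)
    finally have "of_real (p z) = \<alpha> * z + \<beta> * cnj z"
      by (simp add: \<alpha>_def \<beta>_def complex_eq_iff field_simps)
    then show ?thesis by (simp add: cnj_circle[OF that] algebra_simps)
  qed
  have i: "integrable circle_measure (\<lambda>z. \<alpha> * (z powi 1 * f z))"
      "integrable circle_measure (\<lambda>z. \<beta> * (z powi -1 * f z))"
    using integrable_power_int_mult[OF linear(2)]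
      by (auto simp del: power_int_1_right power_int_minus1_right)
  have "integrable circle_measure (\<lambda>z. of_real (p z) * f z)
        \<longleftrightarrow> integrable circle_measure (\<lambda>z. \<alpha> * (z powi 1 * f z) + \<beta> * (z powi -1 * f z))"
    by (intro Bochner_Integration.integrable_cong) (auto simp: p)
  moreover have "fourier_coeff (\<lambda>z. of_real (p z) * f z) k = 0" for k
  proof -
    have "fourier_coeff (\<lambda>z. of_real (p z) * f z) k
          = fourier_coeff (\<lambda>z. \<alpha> * (z powi 1 * f z) + \<beta> * (z powi -1 * f z)) k"
      by (rule fourier_coeff_cong) (rule p)
    then show ?thesis
      unfolding fourier_coeff_add[OF i] fourier_coeff_cmult fourier_coeff_shift by (simp add: linear)
  qed
  ultimately show ?case using i by auto
next
  case (const c)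
  then show ?case by (simp add: fourier_coeff_cmult)
next
  case (add p q)
  then have p: "integrable circle_measure (\<lambda>z. of_real (p z) * f z)"
    "\<And>k. fourier_coeff (\<lambda>z. of_real (p z) * f z) k = 0"
    and q: "integrable circle_measure (\<lambda>z. of_real (q z) * f z)"
    "\<And>k. fourier_coeff (\<lambda>z. of_real (q z) * f z) k = 0" by blast+
  then show ?case by (simp add: distrib_right fourier_coeff_add)
next
  case (mult p q)
  then have "integrable circle_measure (\<lambda>z. of_real (q z) * f z)"
    "\<And>k. fourier_coeff (\<lambda>z. of_real (q z) * f z) k = 0" by blast+
  \<comment> \<open>The claim for \<open>p\<close> is applied to the function \<open>q * f\<close>;
    for this reason the induction generalizes over \<open>f\<close>.\<close>
  from mult.IH(1)[OF this] show ?case by (simp add: mult.assoc)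
qed

text \<open>The indicator of a nonempty closed set is the pointwise limit of continuous functions
  with values in [0,1], and dominated convergence applies with the bound
  \<open>norm (f z)\<close>.\<close>

lemma set_integral_closed_eq_0:
  fixes f :: "complex \<Rightarrow> complex"
  assumes f: "integrable circle_measure f"
    and *: "\<And>g. continuous_on UNIV g \<Longrightarrow> (LINT z|circle_measure. of_real (g z) * f z) = 0"
    and "closed A"
  shows "(LINT z:A|circle_measure. f z) = 0"
\<comment> \<open>The empty set is separated because \<open>infdist\<close> to it is 0 by
  convention, which would make every \<open>g n\<close> constantly 1.\<close>
proof (cases "A = {}")
  case False
  define g where "g = (\<lambda>n z. max 0 (1 - real n * infdist z A))"
  have c: "continuous_on UNIV (g n)" for n
    unfolding g_def by (intro continuous_intros)
  then have gm: "g n \<in> borel_measurable borel" for n by (intro borel_measurable_continuous_onI)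
  have [measurable]: "g n \<in> borel_measurable circle_measure" for n
    using gm by (rule borel_measurable_circleI)
  have [measurable]: "A \<in> sets borel" using \<open>closed A\<close> by simp
  note [measurable] = borel_measurable_integrable[OF f]
  have ind: "indicat_real A \<in> borel_measurable circle_measure"
    by (rule borel_measurable_circleI) simp
  have lim: "(\<lambda>n. g n z) \<longlonglongrightarrow> indicator A z" for z
  proof (cases "z \<in> A")
    case True
    then show ?thesis by (simp add: g_def)
  next
    case z: False
    then have "infdist z A > 0"
      using in_closed_iff_infdist_zero[OF \<open>closed A\<close> False, of z] infdist_nonneg[of z A] by linarith
    then obtain N :: nat where N: "1 / infdist z A < real N" using reals_Archimedean2 by blast
    have "g n z = 0" if "n \<ge> N" for n
    proof -
      have "1 / infdist z A < real n" using N that by (meson less_le_trans of_nat_le_iff)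
      then show ?thesis using \<open>infdist z A > 0\<close> by (simp add: g_def field_simps)
    qed
    then show ?thesis using z by (auto intro!: tendsto_eventually eventually_sequentiallyI[of N])
  qed
  have "(\<lambda>n. LINT z|circle_measure. of_real (g n z) * f z)
      \<longlonglongrightarrow> (LINT z|circle_measure. of_real (indicator A z) * f z)"
  proof (rule integral_dominated_convergence[where w="\<lambda>z. norm (f z)"])
    show "AE z in circle_measure. (\<lambda>n. of_real (g n z) * f z) \<longlonglongrightarrow> of_real (indicator A z) * f z"
      by (intro AE_I2 tendsto_intros lim)
    show "AE z in circle_measure. norm (of_real (g n z) * f z) \<le> norm (f z)" for n
    proof (intro AE_I2)
      fix z
      have "\<bar>g n z\<bar> \<le> 1" by (auto simp: g_def infdist_nonneg)
      then show "norm (of_real (g n z) * f z) \<le> norm (f z)"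
        by (simp add: norm_mult mult_left_le_one_le)
    qed
  qed (use f ind in \<open>auto simp del: of_real_indicator\<close>)
  then have "(LINT z|circle_measure. of_real (indicator A z) * f z) = 0"
    by (simp add: *[OF c] LIMSEQ_const_iff)
  then show ?thesis by (simp only: set_lebesgue_integral_def scaleR_conv_of_real)
qed (simp add: set_lebesgue_integral_def)

text \<open>Three approximations lead from characters to sets: Stone-Weierstrass reaches continuous
  test functions, the preceding lemma reaches closed sets, and Dynkin's argument reaches all Borel
  sets. A function whose integral over every measurable set is 0 vanishes almost everywhere.\<close>

theorem fourier_coeff_unique_zero:
  assumes f: "integrable circle_measure f" and 0: "\<And>k. fourier_coeff f k = 0"
  shows "AE z in circle_measure. f z = 0"
proof (rule circle.density_zero[OF f])
  have cont0: "(LINT z|circle_measure. of_real (g z) * f z) = 0" if g: "continuous_on UNIV g" for g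
  proof -
    have gm: "(\<lambda>z. complex_of_real (g z)) \<in> borel_measurable circle_measure"
      using g by (intro borel_measurable_circleI borel_measurable_continuous_onI continuous_intros)
    obtain B where B: "\<And>z. z \<in> sphere 0 1 \<Longrightarrow> norm (g z) \<le> B"
      using compact_imp_bounded[OF compact_continuous_image[OF continuous_on_subset[OF g] compact_sphere[of 0 1]]]
      unfolding bounded_iff by (metis image_eqI subset_UNIV)
    have gi: "integrable circle_measure (\<lambda>z. of_real (g z) * f z)"
      by (rule integrable_mult_bounded[OF f gm, of B]) (use B in auto)
    have "norm (LINT z|circle_measure. of_real (g z) * f z) \<le> e * (LINT z|circle_measure. norm (f z))"
      if "e > 0" for e
    proof -
      obtain p where p: "real_polynomial_function p" "\<And>z. z \<in> sphere 0 1 \<Longrightarrow> \<bar>g z - p z\<bar> < e"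
        using Stone_Weierstrass_real_polynomial_function[OF compact_sphere continuous_on_subset[OF g] \<open>e > 0\<close>]
        by (metis subset_UNIV)
      from fourier_coeff_real_polynomial_zero[OF p(1) f 0]
      have pf: "integrable circle_measure (\<lambda>z. of_real (p z) * f z)"
        "fourier_coeff (\<lambda>z. of_real (p z) * f z) 0 = 0" by blast+
      then have "(LINT z|circle_measure. of_real (g z) * f z)
          = (LINT z|circle_measure. of_real (g z) * f z - of_real (p z) * f z)"
        by (subst Bochner_Integration.integral_diff[OF gi pf(1)]) (simp add: fourier_coeff_def)
      also have "norm \<dots> \<le> (LINT z|circle_measure. e * norm (f z))"
      proof (rule order_trans[OF integral_norm_bound integral_mono])
        fix z assume "z \<in> space circle_measure"
        then have "\<bar>g z - p z\<bar> * norm (f z) \<le> e * norm (f z)"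
          using p(2)[of z] by (intro mult_right_mono) auto
        then show "norm (of_real (g z) * f z - of_real (p z) * f z) \<le> e * norm (f z)"
          by (simp add: norm_mult flip: left_diff_distrib of_real_diff)
      qed (use gi pf f in auto)
      finally show ?thesis by simp
    qed
    note le = this
    show ?thesis
    proof (rule ccontr)
      assume "(LINT z|circle_measure. of_real (g z) * f z) \<noteq> 0"
      define x where "x = norm (LINT z|circle_measure. of_real (g z) * f z)"
      define K where "K = (LINT z|circle_measure. norm (f z))"
      have "x > 0" "K \<ge> 0" using \<open>_ \<noteq> 0\<close> by (auto simp: x_def K_def)
      \<comment> \<open>This choice of \<open>e\<close> bounds \<open>x\<close> by less than
        \<open>x / 2\<close>; the summand 1 keeps the denominator positive when
        \<open>K = 0\<close>.\<close>
      then have "x \<le> x / (2 * (K + 1)) * K"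
        using le[of "x / (2 * (K + 1))"] \<open>x > 0\<close> \<open>K \<ge> 0\<close>
        unfolding x_def[symmetric] K_def[symmetric] by simp
      then have "x * K + x * 2 \<le> 0" using \<open>K \<ge> 0\<close> by (simp add: field_simps)
      moreover have "x * K \<ge> 0" using \<open>x > 0\<close> \<open>K \<ge> 0\<close> by (intro mult_nonneg_nonneg) auto
      ultimately show False using \<open>x > 0\<close> by linarith
    qed
  qed
  fix A assume "A \<in> sets circle_measure"
  then obtain B where B: "B \<in> sigma_sets UNIV (Collect closed)" "A = B \<inter> sphere 0 1"
    unfolding sets_circle_measure sets_restrict_space
    by (auto simp: borel_eq_closed)
  have S: "C \<inter> sphere 0 1 \<in> sets circle_measure" if "C \<in> sigma_sets UNIV (Collect closed)" for C
    using that unfolding sets_circle_measure sets_restrict_space by (auto simp: borel_eq_closed)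
  have int: "set_integrable circle_measure C f" if "C \<in> sets circle_measure" for C
    unfolding set_integrable_def by (intro integrable_mult_indicator f that)
  have tot: "(LINT z:sphere 0 1|circle_measure. f z) = 0"
    using 0[of 0] set_integral_space[OF f] by (simp add: fourier_coeff_def)
  have "(LINT z:B \<inter> sphere 0 1|circle_measure. f z) = 0"
  \<comment> \<open>Closed sets form a generator stable under intersections, so only complements and
    disjoint countable unions remain.\<close>
  proof (induction rule: sigma_sets_induct_disjoint[OF _ _ B(1)])
    case (3 A)
    then show ?case using set_integral_closed_eq_0[OF f cont0] by (simp add: closed_Int)
  next
    case (5 A)
    \<comment> \<open>The integral over a complement is found from the total integral, which is the
      coefficient of index 0.\<close>
    have "sphere 0 1 = (A \<inter> sphere 0 1) \<union> ((UNIV - A) \<inter> sphere 0 1)" by auto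
    then have "(LINT z:sphere 0 1|circle_measure. f z)
       = (LINT z:(A \<inter> sphere 0 1) \<union> ((UNIV - A) \<inter> sphere 0 1)|circle_measure. f z)" by simp
    also have "\<dots>
        = (LINT z:A \<inter> sphere 0 1|circle_measure. f z) + (LINT z:(UNIV - A) \<inter> sphere 0 1|circle_measure. f z)"
      by (intro set_integral_Un int S sigma_sets.Compl 5) auto
    finally show ?case using 5 tot by simp
  next
    case (6 A)
    have A: "A i \<inter> sphere 0 1 \<in> sets circle_measure" for i using 6 by (intro S) auto
    have "(LINT z:(\<Union>i. A i \<inter> sphere 0 1)|circle_measure. f z)
        = (\<Sum>i. LINT z:A i \<inter> sphere 0 1|circle_measure. f z)"
      using 6(1) A by (intro lebesgue_integral_countable_add int sets.countable_UN)
          (auto simp: disjoint_family_on_def)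
    then show ?case by (simp add: 6)
  qed (auto simp: Int_stable_def set_lebesgue_integral_def)
  then show "(LINT z:A|circle_measure. f z) = 0"
    by (simp add: B(2))
qed

section \<open>The spaces \<open>L\<^sup>2\<close> and \<open>L\<^sup>\<infinity>\<close>\<close>


text \<open>
  A subsequence whose increments \<open>d\<^sub>k\<close> satisfy \<open>\<integral>|d\<^sub>k|\<^sup>2 \<le> 8\<^sup>-\<^sup>k\<close> converges almost everywhere, because
  \<open>\<Sum>4\<^sup>k|d\<^sub>k|\<^sup>2\<close> is integrable; Fatou's lemma transfers the Cauchy estimate to the limit.
\<close>

lemma L2_complete:
  fixes s :: "nat \<Rightarrow> 'a \<Rightarrow> complex"
  assumes [measurable]: "\<And>n. s n \<in> borel_measurable M"
    and Cauchy: "\<And>e. e > 0 \<Longrightarrow> \<exists>N. \<forall>m\<ge>N. \<forall>n\<ge>N. (\<integral>\<^sup>+x. ennreal ((norm (s m x - s n x))\<^sup>2) \<partial>M) \<le> ennreal e"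
  obtains g where "g \<in> borel_measurable M"
    and "\<And>e. e > 0 \<Longrightarrow> \<exists>N. \<forall>n\<ge>N. (\<integral>\<^sup>+x. ennreal ((norm (s n x - g x))\<^sup>2) \<partial>M) \<le> ennreal e"
proof -
  have "\<forall>k. \<exists>N. \<forall>m\<ge>N. \<forall>n\<ge>N. (\<integral>\<^sup>+x. ennreal ((norm (s m x - s n x))\<^sup>2) \<partial>M) \<le> ennreal ((1/8) ^ k)"
    by (intro allI Cauchy) simp
  then obtain N where N: "\<And>k m n. m \<ge> N k \<Longrightarrow> n \<ge> N k \<Longrightarrow>
      (\<integral>\<^sup>+x. ennreal ((norm (s m x - s n x))\<^sup>2) \<partial>M) \<le> ennreal ((1/8) ^ k)"
    by metis
  \<comment> \<open>The summand \<open>k\<close> makes \<open>r\<close> unbounded; the sum makes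
    both \<open>r k\<close> and \<open>r (Suc k)\<close> at least \<open>N k\<close>.\<close>
  define r where "r k = k + (\<Sum>i\<le>k. N i)" for k
  have r: "r k \<ge> k" "r k \<ge> N k" "r (Suc k) \<ge> N k" for k
    using member_le_sum[of k "{..k}" N] by (auto simp: r_def)
  define d where "d k x = s (r (Suc k)) x - s (r k) x" for k x
  have [measurable]: "d k \<in> borel_measurable M" for k unfolding d_def by measurable
  have "(\<integral>\<^sup>+x. (\<Sum>k. ennreal (4 ^ k * (norm (d k x))\<^sup>2)) \<partial>M)
      = (\<Sum>k. \<integral>\<^sup>+x. ennreal (4 ^ k * (norm (d k x))\<^sup>2) \<partial>M)"
    by (intro nn_integral_suminf) measurable
  also have "\<dots> \<le> (\<Sum>k. ennreal ((1/2) ^ k))"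
  proof (intro suminf_le)
    fix k
    have "(\<integral>\<^sup>+x. ennreal (4 ^ k * (norm (d k x))\<^sup>2) \<partial>M)
        = ennreal (4 ^ k) * (\<integral>\<^sup>+x. ennreal ((norm (d k x))\<^sup>2) \<partial>M)"
      by (subst nn_integral_cmult[symmetric]) (auto simp: ennreal_mult')
    also have "\<dots> \<le> ennreal (4 ^ k) * ennreal ((1/8) ^ k)"
      unfolding d_def by (intro mult_left_mono N r) simp
    also have "\<dots> = ennreal ((1/2) ^ k)"
      by (simp flip: ennreal_mult' add: power_mult_distrib[symmetric])
    finally show "(\<integral>\<^sup>+x. ennreal (4 ^ k * (norm (d k x))\<^sup>2) \<partial>M) \<le> ennreal ((1/2) ^ k)" .
  qed auto
  also have "\<dots> < \<infinity>"
    by (subst suminf_ennreal_eq[OF _ geometric_sums]) auto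
  finally have "AE x in M. (\<Sum>k. ennreal (4 ^ k * (norm (d k x))\<^sup>2)) \<noteq> \<infinity>"
    by (intro nn_integral_PInf_AE) auto
  then have conv: "AE x in M. convergent (\<lambda>k. s (r k) x)"
  proof eventually_elim
    case (elim x)
    then have "summable (\<lambda>k. 4 ^ k * (norm (d k x))\<^sup>2)"
      by (intro summable_suminf_not_top) auto
    then have "eventually (\<lambda>k. 4 ^ k * (norm (d k x))\<^sup>2 < 1) sequentially"
      by (intro order_tendstoD(2)[OF summable_LIMSEQ_zero]) auto
    then have "eventually (\<lambda>k. norm (d k x) \<le> (1/2) ^ k) sequentially"
    proof eventually_elim
      case (elim k)
      have "(4::real) ^ k = (2 ^ k)\<^sup>2" by (simp add: power2_eq_square flip: power_mult_distrib)
      with elim have "(2 ^ k * norm (d k x))\<^sup>2 < 1\<^sup>2" by (simp add: power_mult_distrib)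
      then have "2 ^ k * norm (d k x) < 1" by (rule power_less_imp_less_base) simp
      then show ?case by (simp add: power_one_over field_simps)
    qed
    then have "summable (\<lambda>k. d k x)"
      by (rule summable_comparison_test_ev) (rule summable_geometric, simp)
    then have "(\<lambda>n. \<Sum>k<n. d k x) \<longlonglongrightarrow> suminf (\<lambda>k. d k x)" by (rule summable_LIMSEQ)
    then have "(\<lambda>n. (\<Sum>k<n. d k x) + s (r 0) x) \<longlonglongrightarrow> suminf (\<lambda>k. d k x) + s (r 0) x"
        by (intro tendsto_intros)
    moreover have "(\<Sum>k<n. d k x) = s (r n) x - s (r 0) x" for n
      unfolding d_def by (rule sum_lessThan_telescope)
    ultimately show ?case by (auto simp: convergent_def)
  qed
  define g where "g x = lim (\<lambda>k. s (r k) x)" for x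
  show ?thesis
  proof
    show [measurable]: "g \<in> borel_measurable M" unfolding g_def by measurable
    fix e :: real assume "e > 0"
    then obtain K where K: "\<And>m n. m \<ge> K \<Longrightarrow> n \<ge> K \<Longrightarrow> (\<integral>\<^sup>+x. ennreal ((norm (s m x - s n x))\<^sup>2) \<partial>M)
        \<le> ennreal e"
      using Cauchy by blast
    have "(\<integral>\<^sup>+x. ennreal ((norm (s n x - g x))\<^sup>2) \<partial>M) \<le> ennreal e" if "n \<ge> K" for n
    proof -
      have "(\<integral>\<^sup>+x. ennreal ((norm (s n x - g x))\<^sup>2) \<partial>M)
          = (\<integral>\<^sup>+x. liminf (\<lambda>k. ennreal ((norm (s n x - s (r k) x))\<^sup>2)) \<partial>M)"
      proof (rule nn_integral_cong_AE)
        show "AE x in M. ennreal ((norm (s n x - g x))\<^sup>2)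
            = liminf (\<lambda>k. ennreal ((norm (s n x - s (r k) x))\<^sup>2))"
          using conv
        proof eventually_elim
          case (elim x)
          then have "(\<lambda>k. s (r k) x) \<longlonglongrightarrow> g x" unfolding g_def by (simp add: convergent_LIMSEQ_iff)
          then have "(\<lambda>k. ennreal ((norm (s n x - s (r k) x))\<^sup>2)) \<longlonglongrightarrow> ennreal ((norm (s n x - g x))\<^sup>2)"
            by (intro tendsto_intros tendsto_ennrealI)
          then show ?case by (metis lim_imp_Liminf sequentially_bot)
        qed
      qed
      also have "\<dots> \<le> liminf (\<lambda>k. \<integral>\<^sup>+x. ennreal ((norm (s n x - s (r k) x))\<^sup>2) \<partial>M)"
        by (rule nn_integral_liminf) measurable
      also have "\<dots> \<le> liminf (\<lambda>k. ennreal e)"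
      proof (rule Liminf_mono, rule eventually_sequentiallyI[of K])
        fix k assume "K \<le> k"
        then have "K \<le> r k" using r(1) le_trans by blast
        then show "(\<integral>\<^sup>+x. ennreal ((norm (s n x - s (r k) x))\<^sup>2) \<partial>M) \<le> ennreal e"
          using K \<open>n \<ge> K\<close> by blast
      qed
      finally show ?thesis by (simp add: Liminf_const)
    qed
    then show "\<exists>N. \<forall>n\<ge>N. (\<integral>\<^sup>+x. ennreal ((norm (s n x - g x))\<^sup>2) \<partial>M) \<le> ennreal e" by blast
  qed
qed

section \<open>Closure properties of the spaces of square-integrable and of bounded
  functions\<close>

lemma L2_measurable: "f \<in> L2 \<Longrightarrow> f \<in> borel_measurable circle_measure"
  by (simp add: L2_def)

lemma L2_iff_nn_integral:
  "f \<in> L2 \<longleftrightarrow> f \<in> borel_measurable circle_measure \<and> (\<integral>\<^sup>+z. ennreal ((norm (f z))\<^sup>2) \<partial>circle_measure) < \<infinity>"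
proof -
  have "(\<lambda>z. (norm (f z))\<^sup>2) \<in> borel_measurable circle_measure" if "f \<in> borel_measurable circle_measure"
    using that by measurable
  then show ?thesis by (auto simp: L2_def integrable_iff_bounded simp del: ennreal_power)
qed

lemma nn_integral_norm_square:
  "f \<in> L2 \<Longrightarrow> (\<integral>\<^sup>+z. ennreal ((norm (f z))\<^sup>2) \<partial>circle_measure)
      = ennreal (LINT z|circle_measure. (norm (f z))\<^sup>2)"
  by (rule nn_integral_eq_integral) (simp_all add: L2_def)

text \<open>The measure is finite, so square integrability implies integrability, and Fourier
  coefficients of \<open>L2\<close> functions are genuine integrals.\<close>

lemma L2_integrable: "f \<in> L2 \<Longrightarrow> integrable circle_measure f"
proof -
  assume f: "f \<in> L2"
  then have "integrable circle_measure (\<lambda>z. (norm (f z))\<^sup>2)" by (simp add: L2_def)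
  note [measurable] = L2_measurable[OF f]
  have "(\<lambda>z. norm (f z)) \<in> borel_measurable circle_measure" by measurable
  from circle.square_integrable_imp_integrable[OF this \<open>integrable circle_measure _\<close>]
  have "integrable circle_measure (\<lambda>z. norm (f z))" .
  then show ?thesis using integrable_norm_iff[OF L2_measurable[OF f]] by blast
qed

lemma L2_add: assumes "f \<in> L2" "g \<in> L2" shows "(\<lambda>z. f z + g z) \<in> L2"
proof -
  have "integrable circle_measure (\<lambda>z. (norm (f z + g z))\<^sup>2)"
  proof (rule Bochner_Integration.integrable_bound)
    show "integrable circle_measure (\<lambda>z. 2 * (norm (f z))\<^sup>2 + 2 * (norm (g z))\<^sup>2)"
      using assms by (auto simp: L2_def)
    have "(norm (f z + g z))\<^sup>2 \<le> 2 * (norm (f z))\<^sup>2 + 2 * (norm (g z))\<^sup>2" for z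
    proof -
      have "(norm (f z + g z))\<^sup>2 \<le> (norm (f z) + norm (g z))\<^sup>2"
        by (intro power_mono norm_triangle_ineq) auto
      also have "\<dots> \<le> 2 * (norm (f z))\<^sup>2 + 2 * (norm (g z))\<^sup>2"
        using sum_squares_bound[of "norm (f z)" "norm (g z)"] by (simp add: power2_sum)
      finally show ?thesis .
    qed
    then show "AE z in circle_measure. norm ((norm (f z + g z))\<^sup>2)
        \<le> norm (2 * (norm (f z))\<^sup>2 + 2 * (norm (g z))\<^sup>2)"
      by (intro AE_I2) simp
  qed (use assms in \<open>auto simp: L2_def\<close>)
  then show ?thesis using assms by (auto simp: L2_def)
qed

lemma L2_Linfty_mult: assumes "f \<in> Linfty" "g \<in> L2" shows "(\<lambda>z. f z * g z) \<in> L2"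
proof -
  from assms obtain B where B: "AE z in circle_measure. norm (f z) \<le> B" by (auto simp: Linfty_def)
  have "integrable circle_measure (\<lambda>z. (norm (f z * g z))\<^sup>2)"
  proof (rule Bochner_Integration.integrable_bound)
    show "integrable circle_measure (\<lambda>z. B\<^sup>2 * (norm (g z))\<^sup>2)"
      using assms by (auto simp: L2_def)
    show "AE z in circle_measure. norm ((norm (f z * g z))\<^sup>2) \<le> norm (B\<^sup>2 * (norm (g z))\<^sup>2)"
      using B
    proof eventually_elim
      case (elim z)
      then show ?case by (auto simp: norm_mult power_mult_distrib intro!: mult_right_mono power_mono)
    qed
  qed (use assms in \<open>auto simp: L2_def Linfty_def\<close>)
  then show ?thesis using assms by (auto simp: L2_def Linfty_def)
qed

lemma Linfty_const [simp]: "(\<lambda>_. c) \<in> Linfty"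
  by (auto simp: Linfty_def)

lemma Linfty_power_int [simp]: "(\<lambda>z. z powi k) \<in> Linfty"
  by (auto simp: Linfty_def norm_power_int intro!: exI[of _ 1] AE_I2)

lemma Linfty_L2: assumes "f \<in> Linfty" shows "f \<in> L2"
proof -
  have "(\<lambda>_. 1) \<in> L2" by (simp add: L2_def)
  from L2_Linfty_mult[OF assms this] show ?thesis by simp
qed

lemma Linfty_add: assumes "f \<in> Linfty" "g \<in> Linfty" shows "(\<lambda>z. f z + g z) \<in> Linfty"
proof -
  from assms obtain B C where "AE z in circle_measure. norm (f z) \<le> B"
      "AE z in circle_measure. norm (g z) \<le> C"
    by (auto simp: Linfty_def)
  then have "AE z in circle_measure. norm (f z + g z) \<le> B + C"
    by eventually_elim (meson add_mono norm_triangle_ineq order_trans)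
  then show ?thesis using assms by (auto simp: Linfty_def)
qed

lemma Linfty_mult: assumes "f \<in> Linfty" "g \<in> Linfty" shows "(\<lambda>z. f z * g z) \<in> Linfty"
proof -
  from assms obtain B C where "AE z in circle_measure. norm (f z) \<le> B"
      "AE z in circle_measure. norm (g z) \<le> C"
    by (auto simp: Linfty_def)
  then have "AE z in circle_measure. norm (f z * g z) \<le> B * C"
  proof eventually_elim
    case (elim z)
    then have "0 \<le> B" using norm_ge_zero order_trans by blast
    with elim show ?case unfolding norm_mult by (intro mult_mono) auto
  qed
  then show ?thesis using assms by (auto simp: Linfty_def)
qed

lemma borel_measurable_cnj [measurable (raw)]:
  "f \<in> borel_measurable M \<Longrightarrow> (\<lambda>x. cnj (f x)) \<in> borel_measurable M"
  by (rule measurable_compose[where N=borel])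
      (auto intro!: borel_measurable_continuous_onI continuous_intros)

lemma Linfty_cnj: "f \<in> Linfty \<Longrightarrow> (\<lambda>z. cnj (f z)) \<in> Linfty"
  by (auto simp: Linfty_def)

lemma L2_cnj: "f \<in> L2 \<Longrightarrow> (\<lambda>z. cnj (f z)) \<in> L2"
  by (auto simp: L2_def)

lemma L2_cmult: "f \<in> L2 \<Longrightarrow> (\<lambda>z. c * f z) \<in> L2"
  by (rule L2_Linfty_mult) simp

lemma L2_diff: "f \<in> L2 \<Longrightarrow> g \<in> L2 \<Longrightarrow> (\<lambda>z. f z - g z) \<in> L2"
  using L2_add[OF _ L2_cmult[of g "-1"]] by simp

lemma L2_sum: "(\<And>i. i \<in> I \<Longrightarrow> f i \<in> L2) \<Longrightarrow> (\<lambda>z. \<Sum>i\<in>I. f i z) \<in> L2"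
  by (induction I rule: infinite_finite_induct) (simp_all add: L2_add Linfty_L2)

lemma Linfty_diff: "f \<in> Linfty \<Longrightarrow> g \<in> Linfty \<Longrightarrow> (\<lambda>z. f z - g z) \<in> Linfty"
  using Linfty_add[OF _ Linfty_mult[OF Linfty_const[of "-1"], of g]] by simp

lemma Linfty_sum: "(\<And>i. i \<in> I \<Longrightarrow> f i \<in> Linfty) \<Longrightarrow> (\<lambda>z. \<Sum>i\<in>I. f i z) \<in> Linfty"
  by (induction I rule: infinite_finite_induct) (simp_all add: Linfty_add)

section \<open>Pairings of square-integrable functions\<close>

lemma L2_mult_integrable:
  assumes "f \<in> L2" "g \<in> L2" shows "integrable circle_measure (\<lambda>z. f z * g z)"
proof (rule Bochner_Integration.integrable_bound)
  show "integrable circle_measure (\<lambda>z. (norm (f z))\<^sup>2 + (norm (g z))\<^sup>2)"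
    using assms by (auto simp: L2_def)
  have "norm (f z) * norm (g z) \<le> (norm (f z))\<^sup>2 + (norm (g z))\<^sup>2" for z
    using sum_squares_bound[of "norm (f z)" "norm (g z)"] zero_le_power2[of "norm (f z)"]
      zero_le_power2[of "norm (g z)"] mult_nonneg_nonneg[OF norm_ge_zero norm_ge_zero, of "f z" "g z"]
    by linarith
  then show "AE z in circle_measure. norm (f z * g z) \<le> norm ((norm (f z))\<^sup>2 + (norm (g z))\<^sup>2)"
    by (intro AE_I2) (simp add: norm_mult)
qed (use assms in \<open>auto simp: L2_def\<close>)

text \<open>Stated for the bilinear pairing, without conjugation, so that it serves inner products
  and Fourier coefficients alike. The inequality itself is taken from nonnegative integrals.\<close>

lemma L2_Cauchy_Schwarz:
  assumes "f \<in> L2" "g \<in> L2"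
  shows "(norm (LINT z|circle_measure. f z * g z))\<^sup>2
         \<le> (LINT z|circle_measure. (norm (f z))\<^sup>2) * (LINT z|circle_measure. (norm (g z))\<^sup>2)"
proof -
  have [measurable]: "f \<in> borel_measurable circle_measure" "g \<in> borel_measurable circle_measure"
    using assms by (auto simp: L2_def)
  have "ennreal ((norm (LINT z|circle_measure. f z * g z))\<^sup>2)
      \<le> (\<integral>\<^sup>+z. ennreal (norm (f z)) * ennreal (norm (g z)) \<partial>circle_measure)\<^sup>2"
    using integral_norm_bound_ennreal[OF L2_mult_integrable[OF assms]]
    by (simp add: ennreal_power[symmetric] norm_mult ennreal_mult' power_mono)
  also have "\<dots>
      \<le> (\<integral>\<^sup>+z. (ennreal (norm (f z)))\<^sup>2 \<partial>circle_measure) * (\<integral>\<^sup>+z. (ennreal (norm (g z)))\<^sup>2 \<partial>circle_measure)"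
    by (rule Cauchy_Schwarz_nn_integral) measurable
  also have "\<dots>
      = ennreal ((LINT z|circle_measure. (norm (f z))\<^sup>2) * (LINT z|circle_measure. (norm (g z))\<^sup>2))"
    by (simp add: ennreal_power nn_integral_norm_square assms ennreal_mult')
  finally show ?thesis by (simp add: ennreal_le_iff)
qed

text \<open>By Cauchy-Schwarz, convergence in norm implies convergence of the pairing with a fixed
  function. All later passages from partial sums to their limits rest on this.\<close>

lemma L2_limit_integral:
  assumes f: "\<And>n. f n \<in> L2" and "g \<in> L2" "h \<in> L2"
    and "(\<lambda>n. LINT z|circle_measure. (norm (f n z - g z))\<^sup>2) \<longlonglongrightarrow> 0"
  shows "(\<lambda>n. LINT z|circle_measure. f n z * h z) \<longlonglongrightarrow> (LINT z|circle_measure. g z * h z)"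
proof -
  let ?H = "LINT z|circle_measure. (norm (h z))\<^sup>2"
  have "(\<lambda>n. (norm ((LINT z|circle_measure. f n z * h z) - (LINT z|circle_measure. g z * h z)))\<^sup>2) \<longlonglongrightarrow> 0"
  proof (rule tendsto_sandwich[OF always_eventually always_eventually tendsto_const])
    show "(\<lambda>n. (LINT z|circle_measure. (norm (f n z - g z))\<^sup>2) * ?H) \<longlonglongrightarrow> 0"
      using tendsto_mult_left_zero[OF assms(4)] .
    show "\<forall>n. (norm ((LINT z|circle_measure. f n z * h z) - (LINT z|circle_measure. g z * h z)))\<^sup>2
        \<le> (LINT z|circle_measure. (norm (f n z - g z))\<^sup>2) * ?H"
    proof
      fix n
      have "(LINT z|circle_measure. f n z * h z) - (LINT z|circle_measure. g z * h z)
          = (LINT z|circle_measure. (f n z - g z) * h z)"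
        using assms
          by (simp add: left_diff_distrib Bochner_Integration.integral_diff L2_mult_integrable)
      then show "(norm ((LINT z|circle_measure. f n z * h z) - (LINT z|circle_measure. g z * h z)))\<^sup>2
        \<le> (LINT z|circle_measure. (norm (f n z - g z))\<^sup>2) * ?H"
        using L2_Cauchy_Schwarz[OF L2_diff[OF f assms(2)] assms(3)] by simp
    qed
  qed simp
  then have "(\<lambda>n. norm ((LINT z|circle_measure. f n z * h z) - (LINT z|circle_measure. g z * h z))) \<longlonglongrightarrow> 0"
    using tendsto_real_sqrt by fastforce
  then show ?thesis using LIM_zero_cancel tendsto_norm_zero_iff by blast
qed

section \<open>The analytic projection\<close>


lemma H2_L2: "f \<in> H2 \<Longrightarrow> f \<in> L2"
  by (simp add: H2_def)

lemma H2_fourier_coeff_neg: "f \<in> H2 \<Longrightarrow> k < 0 \<Longrightarrow> fourier_coeff f k = 0"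
  by (simp add: H2_def)

lemma L2_AE_eqI:
  assumes "f \<in> L2" "g \<in> L2" "\<And>k. fourier_coeff f k = fourier_coeff g k"
  shows "AE z in circle_measure. f z = g z"
proof -
  have "AE z in circle_measure. f z - g z = 0"
    by (rule fourier_coeff_unique_zero) (auto simp: assms fourier_coeff_diff L2_integrable)
  then show ?thesis by simp
qed

section \<open>Trigonometric polynomials and the Bessel inequality\<close>

definition trig_poly :: "int set \<Rightarrow> (int \<Rightarrow> complex) \<Rightarrow> complex \<Rightarrow> complex" where
  "trig_poly I a z = (\<Sum>k\<in>I. a k * z powi k)"

lemma trig_poly_L2: "trig_poly I a \<in> L2"
  unfolding trig_poly_def[abs_def] by (intro L2_sum L2_cmult Linfty_L2 Linfty_power_int)

lemma fourier_coeff_trig_poly: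
  "finite I \<Longrightarrow> fourier_coeff (trig_poly I a) k = (if k \<in> I then a k else 0)"
  unfolding trig_poly_def[abs_def]
  by (subst fourier_coeff_sum)
     (simp_all add: fourier_coeff_cmult fourier_coeff_power_int
         L2_integrable L2_cmult Linfty_L2 if_distrib sum.delta cong: if_cong)

lemma L2_inner_trig_poly:
  assumes "g \<in> L2"
  shows "L2_inner g (trig_poly I a) = (\<Sum>k\<in>I. cnj (a k) * fourier_coeff g k)"
proof -
  have "L2_inner g (trig_poly I a) = (LINT z|circle_measure. (\<Sum>k\<in>I. cnj (a k) * (g z * z powi (- k))))"
    unfolding L2_inner_def
    by (intro Bochner_Integration.integral_cong refl)
       (simp add: trig_poly_def
           sum_distrib_left cnj_power_int_circle mult_ac del: complex_cnj_power_int)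
  also have "\<dots> = (\<Sum>k\<in>I. cnj (a k) * fourier_coeff g k)"
    using assms by (simp add: fourier_coeff_def L2_integrable integrable_mult_power_int)
  finally show ?thesis .
qed

lemma L2_inner_self: "L2_inner f f = of_real (LINT z|circle_measure. (norm (f z))\<^sup>2)"
  unfolding L2_inner_def by (simp add: complex_norm_square[symmetric] flip: integral_complex_of_real)

text \<open>Parseval's identity for finite sums: pairing the polynomial with itself reads off its
  own coefficients.\<close>

lemma norm_trig_poly:
  assumes "finite I"
  shows "(LINT z|circle_measure. (norm (trig_poly I a z))\<^sup>2) = (\<Sum>k\<in>I. (norm (a k))\<^sup>2)"
proof -
  have "complex_of_real (LINT z|circle_measure. (norm (trig_poly I a z))\<^sup>2) = (\<Sum>k\<in>I. cnj (a k) * a k)"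
    using L2_inner_trig_poly[OF trig_poly_L2, of I a I a] assms
    by (simp add: L2_inner_self fourier_coeff_trig_poly)
  also have "\<dots> = of_real (\<Sum>k\<in>I. (norm (a k))\<^sup>2)"
    by (simp add: complex_norm_square mult.commute del: of_real_power)
  finally show ?thesis by (simp only: of_real_eq_iff)
qed

text \<open>With \<open>?p\<close> the partial sum of \<open>f\<close> over \<open>I\<close>, both
  the pairing of \<open>f\<close> with \<open>?p\<close> and the squared norm of \<open>?p\<close>
  equal \<open>S\<close>. Cauchy-Schwarz then bounds the square of \<open>S\<close> by
  \<open>S\<close> times the squared norm of \<open>f\<close>, and \<open>S\<close> cancels.\<close>

lemma Bessel_inequality:
  assumes "f \<in> L2" "finite I"
  shows "(\<Sum>k\<in>I. (norm (fourier_coeff f k))\<^sup>2) \<le> (LINT z|circle_measure. (norm (f z))\<^sup>2)"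
proof -
  define S where "S = (\<Sum>k\<in>I. (norm (fourier_coeff f k))\<^sup>2)"
  let ?p = "trig_poly I (fourier_coeff f)"
  have "L2_inner f ?p = of_real S"
    unfolding L2_inner_trig_poly[OF assms(1)] S_def
    by (simp add: complex_norm_square mult.commute del: of_real_power)
  then have "S\<^sup>2 = (norm (L2_inner f ?p))\<^sup>2" by simp
  also have "\<dots> \<le> (LINT z|circle_measure. (norm (f z))\<^sup>2) * S"
    using L2_Cauchy_Schwarz[OF assms(1) L2_cnj[OF trig_poly_L2], of I "fourier_coeff f"]
    by (simp add: L2_inner_def norm_trig_poly[OF assms(2)] S_def)
  finally have "S * S \<le> (LINT z|circle_measure. (norm (f z))\<^sup>2) * S" by (simp add: power2_eq_square)
  moreover have "S \<ge> 0" by (simp add: S_def sum_nonneg)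
  ultimately show ?thesis unfolding S_def[symmetric]
    by (cases "S = 0") auto
qed

text \<open>Existence of the projection. Partial sums over nonnegative indices are Cauchy by Bessel,
  and their limit inherits the coefficients. Convergence is part of the conclusion because density
  arguments in \<open>H2\<close> use it.\<close>

lemma Riesz_Fischer_H2:
  assumes f: "f \<in> L2"
  defines "S \<equiv> \<lambda>n. trig_poly {0..<int n} (fourier_coeff f)"
  obtains g where "g \<in> H2" "\<And>k. k \<ge> 0 \<Longrightarrow> fourier_coeff g k = fourier_coeff f k"
    "(\<lambda>n. LINT z|circle_measure. (norm (S n z - g z))\<^sup>2) \<longlonglongrightarrow> 0"
proof -
  define c where "c k = (norm (fourier_coeff f (int k)))\<^sup>2" for k
  have SL2: "S n \<in> L2" for n unfolding S_def by (rule trig_poly_L2)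
  have coeff_S: "fourier_coeff (S n) k = (if 0 \<le> k \<and> k < int n then fourier_coeff f k else 0)" for n k
    unfolding S_def by (simp add: fourier_coeff_trig_poly)
  have sum_int: "(\<Sum>k\<in>{int m..<int n}. (norm (fourier_coeff f k))\<^sup>2) = (\<Sum>k\<in>{m..<n}. c k)" for m n
    unfolding c_def by (subst image_int_atLeastLessThan[symmetric], subst sum.reindex)
        (auto intro: inj_onI)
  have "summable c"
  proof (rule summableI_nonneg_bounded)
    show "sum c {..<n} \<le> (LINT z|circle_measure. (norm (f z))\<^sup>2)" for n
      using Bessel_inequality[OF f, of "{0..<int n}"] sum_int[of 0 n] by (simp add: lessThan_atLeast0)
  qed (simp add: c_def)
  \<comment> \<open>The difference of two partial sums is the trigonometric polynomial over the
    indices in between, so its norm is a block of the series of the \<open>c k\<close>.\<close>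
  have diff: "(\<integral>\<^sup>+z. ennreal ((norm (S n z - S m z))\<^sup>2) \<partial>circle_measure) = ennreal (\<Sum>k\<in>{m..<n}. c k)"
    if "m \<le> n" for m n
  proof -
    have "S n z - S m z = trig_poly {int m..<int n} (fourier_coeff f) z" for z
    proof -
      have "{0..<int n} = {0..<int m} \<union> {int m..<int n}" using that by auto
      then show ?thesis unfolding S_def trig_poly_def
        by (simp add: sum.union_disjoint)
    qed
    then show ?thesis
      by (simp add: nn_integral_norm_square[OF trig_poly_L2] norm_trig_poly sum_int)
  qed
  have Cauchy: "\<exists>N. \<forall>m\<ge>N. \<forall>n\<ge>N. (\<integral>\<^sup>+z. ennreal ((norm (S m z - S n z))\<^sup>2) \<partial>circle_measure) \<le> ennreal e"
    if "e > 0" for e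
  proof -
    obtain N where N: "\<And>m n. m \<ge> N \<Longrightarrow> norm (\<Sum>k\<in>{m..<n}. c k) < e"
      using \<open>summable c\<close> \<open>e > 0\<close> unfolding summable_Cauchy by blast
    have *: "(\<integral>\<^sup>+z. ennreal ((norm (S n z - S m z))\<^sup>2) \<partial>circle_measure)
        \<le> ennreal e" if "m \<ge> N" "m \<le> n" for m n
      using N[OF that(1), of n] by (auto simp: diff[OF that(2)] intro!: ennreal_leI)
    have "(\<integral>\<^sup>+z. ennreal ((norm (S m z - S n z))\<^sup>2) \<partial>circle_measure)
        \<le> ennreal e" if "m \<ge> N" "n \<ge> N" for m n
      using *[of m n] *[of n m] that by (cases "m \<le> n") (auto simp: norm_minus_commute)
    then show ?thesis by blast
  qed
  obtain g where g: "g \<in> borel_measurable circle_measure"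
    and lim: "\<And>e. e > 0 \<Longrightarrow> \<exists>N. \<forall>n\<ge>N. (\<integral>\<^sup>+z. ennreal ((norm (S n z - g z))\<^sup>2) \<partial>circle_measure)
        \<le> ennreal e"
    using L2_complete[of S circle_measure, OF L2_measurable[OF SL2] Cauchy] by blast
  have gL2: "g \<in> L2"
  proof -
    obtain n where "(\<integral>\<^sup>+z. ennreal ((norm (S n z - g z))\<^sup>2) \<partial>circle_measure) \<le> ennreal 1"
      using lim[of 1] by auto
    then have "(\<lambda>z. S n z - g z) \<in> L2"
      using g L2_measurable[OF SL2, of n] by (auto simp: L2_iff_nn_integral intro: le_less_trans)
    from L2_diff[OF SL2[of n] this] show ?thesis by simp
  qed
  have lim0: "(\<lambda>n. LINT z|circle_measure. (norm (S n z - g z))\<^sup>2) \<longlonglongrightarrow> 0"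
  proof (rule LIMSEQ_I)
    fix e :: real assume "e > 0"
    then obtain N where N: "\<And>n. n \<ge> N \<Longrightarrow> (\<integral>\<^sup>+z. ennreal ((norm (S n z - g z))\<^sup>2) \<partial>circle_measure)
        \<le> ennreal (e / 2)"
      using lim[of "e / 2"] by auto
    have "norm ((LINT z|circle_measure. (norm (S n z - g z))\<^sup>2) - 0) < e" if "n \<ge> N" for n
    proof -
      have "(LINT z|circle_measure. (norm (S n z - g z))\<^sup>2) \<le> e / 2"
        using N[OF that] \<open>e > 0\<close> by (simp add: nn_integral_norm_square L2_diff SL2 gL2 ennreal_le_iff)
      then show ?thesis using \<open>e > 0\<close> by simp
    qed
    then show "\<exists>N. \<forall>n\<ge>N. norm ((LINT z|circle_measure. (norm (S n z - g z))\<^sup>2) - 0) < e" by blast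
  qed
  have coeff: "(\<lambda>n. fourier_coeff (S n) k) \<longlonglongrightarrow> fourier_coeff g k" for k
    unfolding fourier_coeff_def
    by (rule L2_limit_integral[OF SL2 gL2 Linfty_L2[OF Linfty_power_int] lim0])
  have neg: "fourier_coeff g k = 0" if "k < 0" for k
    using coeff[of k] that by (simp add: coeff_S LIMSEQ_const_iff)
  have pos: "fourier_coeff g k = fourier_coeff f k" if "k \<ge> 0" for k
  proof -
    have "(\<lambda>n. fourier_coeff (S n) k) \<longlonglongrightarrow> fourier_coeff f k"
      \<comment> \<open>From \<open>n = nat k + 1\<close> on, the index \<open>k\<close> belongs to
        the partial sum and the coefficient is constant in \<open>n\<close>.\<close>
      using that by (intro tendsto_eventually eventually_sequentiallyI[of "nat k + 1"])
          (auto simp: coeff_S)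
    then show ?thesis using coeff LIMSEQ_unique by blast
  qed
  show ?thesis
    by (rule that[OF _ pos lim0]) (use gL2 neg in \<open>auto simp: H2_def\<close>)
qed

text \<open>The limit given by \<open>Riesz_Fischer_H2\<close> has the coefficients of
  \<open>h\<close>, at negative indices because both vanish there, and hence equals \<open>h\<close>
  almost everywhere.\<close>

lemma H2_partial_sums:
  assumes h: "h \<in> H2"
  shows "(\<lambda>n. LINT z|circle_measure. (norm (trig_poly {0..<int n} (fourier_coeff h) z - h z))\<^sup>2) \<longlonglongrightarrow> 0"
proof -
  obtain g where g: "g \<in> H2" "\<And>k. k \<ge> 0 \<Longrightarrow> fourier_coeff g k = fourier_coeff h k"
    "(\<lambda>n. LINT z|circle_measure. (norm (trig_poly {0..<int n} (fourier_coeff h) z - g z))\<^sup>2) \<longlonglongrightarrow> 0"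
    using Riesz_Fischer_H2[OF H2_L2[OF h]] by blast
  have "AE z in circle_measure. g z = h z"
  proof (rule L2_AE_eqI)
    show "fourier_coeff g k = fourier_coeff h k" for k
      by (cases "k \<ge> 0") (use g h H2_fourier_coeff_neg in auto)
  qed (use g h H2_L2 in auto)
  then have "(LINT z|circle_measure. (norm (trig_poly {0..<int n} (fourier_coeff h) z - g z))\<^sup>2)
     = (LINT z|circle_measure. (norm (trig_poly {0..<int n} (fourier_coeff h) z - h z))\<^sup>2)" for n
    using L2_measurable[OF H2_L2[OF h]] L2_measurable[OF H2_L2[OF g(1)]]
      L2_measurable[OF trig_poly_L2, of "{0..<int n}" "fourier_coeff h"]
    by (intro integral_cong_AE) auto
  with g(3) show ?thesis by simp
qed

text \<open>Orthogonality to the powers of \<open>z\<close> with nonnegative exponent extends to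
  \<open>H2\<close> through partial sums.\<close>

lemma L2_inner_H2_eq_0:
  assumes "f \<in> L2" "\<And>k. k \<ge> 0 \<Longrightarrow> fourier_coeff f k = 0" "h \<in> H2"
  shows "L2_inner f h = 0"
proof -
  let ?S = "\<lambda>n. trig_poly {0..<int n} (fourier_coeff h)"
  have "(\<lambda>n. LINT z|circle_measure. cnj (?S n z) * f z) \<longlonglongrightarrow> (LINT z|circle_measure. cnj (h z) * f z)"
  proof (rule L2_limit_integral)
    show "(\<lambda>n. LINT z|circle_measure. (norm (cnj (?S n z) - cnj (h z)))\<^sup>2) \<longlonglongrightarrow> 0"
      using H2_partial_sums[OF assms(3)] by (simp flip: complex_cnj_diff)
  qed (use assms in \<open>auto intro: L2_cnj trig_poly_L2 H2_L2\<close>)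
  moreover have "(LINT z|circle_measure. cnj (?S n z) * f z) = 0" for n
    using L2_inner_trig_poly[OF assms(1), of "{0..<int n}" "fourier_coeff h"] assms(2)
    by (simp add: L2_inner_def mult.commute)
  ultimately show ?thesis by (simp add: LIMSEQ_const_iff L2_inner_def mult.commute)
qed

section \<open>The projection described by its coefficients\<close>

lemma H2_power_int: "k \<ge> 0 \<Longrightarrow> (\<lambda>z. z powi k) \<in> H2"
  by (simp add: H2_def Linfty_L2 fourier_coeff_power_int)

lemma L2_inner_power_int: "L2_inner f (\<lambda>z. z powi k) = fourier_coeff f k"
  unfolding L2_inner_def fourier_coeff_def
  by (intro Bochner_Integration.integral_cong refl)
     (simp add: cnj_power_int_circle del: complex_cnj_power_int)

text \<open>Riesz-Fischer shows that the choice in the definition is possible. Whatever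
  representative is chosen, testing it against \<open>z powi k\<close> for \<open>k \<ge> 0\<close>
  determines its coefficients.\<close>

lemma riesz_proj:
  assumes f: "f \<in> L2"
  shows riesz_proj_H2: "riesz_proj f \<in> H2"
    and L2_inner_riesz_proj: "h \<in> H2 \<Longrightarrow> L2_inner (\<lambda>z. f z - riesz_proj f z) h = 0"
    and fourier_coeff_riesz_proj: "k \<ge> 0 \<Longrightarrow> fourier_coeff (riesz_proj f) k = fourier_coeff f k"
proof -
  obtain g where g: "g \<in> H2" "\<And>k. k \<ge> 0 \<Longrightarrow> fourier_coeff g k = fourier_coeff f k"
    using Riesz_Fischer_H2[OF f] by blast
  have "L2_inner (\<lambda>z. f z - g z) h = 0" if "h \<in> H2" for h
    using that g f
    by (intro L2_inner_H2_eq_0) (auto simp: fourier_coeff_diff L2_integrable L2_diff H2_L2)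
  with g(1) have "\<exists>g. g \<in> H2 \<and> (\<forall>h\<in>H2. L2_inner (\<lambda>z. f z - g z) h = 0)" by blast
  from someI_ex[OF this] have *: "riesz_proj f \<in> H2" "\<forall>h\<in>H2. L2_inner (\<lambda>z. f z - riesz_proj f z) h = 0"
    unfolding riesz_proj_def by blast+
  then show "riesz_proj f \<in> H2" "h \<in> H2 \<Longrightarrow> L2_inner (\<lambda>z. f z - riesz_proj f z) h = 0" by auto
  show "fourier_coeff (riesz_proj f) k = fourier_coeff f k" if "k \<ge> 0"
    using *(2)[rule_format, OF H2_power_int[OF that]] f *(1)
    by (simp add: L2_inner_power_int fourier_coeff_diff L2_integrable H2_L2)
qed

text \<open>A convolution argument: for a partial sum of \<open>h\<close> the coefficient is a
  finite sum over \<open>m\<close> of products of coefficients with indices \<open>m\<close> and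
  \<open>k - m\<close>. Since \<open>k < p\<close>, either \<open>m < p\<close> or
  \<open>k - m < 0\<close>. The condition \<open>p \<ge> 0\<close> places \<open>h\<close> in
  \<open>H2\<close>, where partial sums converge.\<close>

lemma fourier_coeff_analytic_mult:
  assumes f: "f \<in> Linfty" "\<And>k. k < 0 \<Longrightarrow> fourier_coeff f k = 0"
    and h: "h \<in> L2" "\<And>k. k < p \<Longrightarrow> fourier_coeff h k = 0"
    and "p \<ge> 0" "k < p"
  shows "fourier_coeff (\<lambda>z. f z * h z) k = 0"
proof -
  have hH2: "h \<in> H2" using h \<open>p \<ge> 0\<close> by (auto simp: H2_def)
  let ?S = "\<lambda>n. trig_poly {0..<int n} (fourier_coeff h)"
  have fz: "(\<lambda>z. z powi (-k) * f z) \<in> L2"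
    by (intro Linfty_L2 Linfty_mult f Linfty_power_int)
  have "(\<lambda>n. LINT z|circle_measure. ?S n z * (z powi (-k) * f z))
      \<longlonglongrightarrow> (LINT z|circle_measure. h z * (z powi (-k) * f z))"
    by (rule L2_limit_integral[OF trig_poly_L2 h(1) fz H2_partial_sums[OF hH2]])
  moreover have "(LINT z|circle_measure. ?S n z * (z powi (-k) * f z)) = 0" for n
  proof -
    have "(LINT z|circle_measure. ?S n z * (z powi (-k) * f z))
        = fourier_coeff (\<lambda>z. \<Sum>m\<in>{0..<int n}. fourier_coeff h m * (z powi m * f z)) k"
      unfolding fourier_coeff_def
      by (intro Bochner_Integration.integral_cong refl)
          (simp add: trig_poly_def sum_distrib_left sum_distrib_right mult_ac)
    also have "\<dots> = (\<Sum>m\<in>{0..<int n}. fourier_coeff h m * fourier_coeff f (k - m))"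
      using L2_integrable[OF Linfty_L2[OF f(1)]]
      by (subst fourier_coeff_sum)
          (simp_all add: fourier_coeff_cmult fourier_coeff_shift integrable_power_int_mult)
    also have "\<dots> = 0"
    proof (intro sum.neutral ballI)
      fix m show "fourier_coeff h m * fourier_coeff f (k - m) = 0"
        using f(2)[of "k - m"] h(2)[of m] \<open>k < p\<close> by (cases "m < p") auto
    qed
    finally show ?thesis .
  qed
  ultimately show ?thesis by (simp add: LIMSEQ_const_iff fourier_coeff_def mult_ac)
qed

text \<open>Conjugation reflects the indices and makes \<open>c\<close> analytic. Coefficients of
  \<open>u\<close> vanish at 0 too, so those of its conjugate vanish below 1, hence
  \<open>p=1\<close>.\<close>

lemma fourier_coeff_coanalytic_mult:
  assumes c: "c \<in> Linfty" "\<And>k. k > 0 \<Longrightarrow> fourier_coeff c k = 0"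
    and u: "u \<in> L2" "\<And>k. k \<ge> 0 \<Longrightarrow> fourier_coeff u k = 0" and "k \<ge> 0"
  shows "fourier_coeff (\<lambda>z. c z * u z) k = 0"
proof -
  have "fourier_coeff (\<lambda>z. cnj (c z) * cnj (u z)) (- k) = 0"
    by (rule fourier_coeff_analytic_mult[where p=1])
       (use assms in \<open>auto simp: fourier_coeff_cnj Linfty_cnj L2_cnj\<close>)
  then show ?thesis using fourier_coeff_cnj[of "\<lambda>z. c z * u z" "- k"] by simp
qed

section \<open>Vector-valued functions and Toeplitz operators\<close>


definition L2_vec :: "(complex \<Rightarrow> complex ^ 'n) set" where
  "L2_vec = {h. \<forall>i. (\<lambda>z. h z $ i) \<in> L2}"

definition vcoeff :: "(complex \<Rightarrow> complex ^ 'n) \<Rightarrow> int \<Rightarrow> complex ^ 'n" where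
  "vcoeff f k = (\<chi> i. fourier_coeff (\<lambda>z. f z $ i) k)"

definition mcoeff :: "(complex \<Rightarrow> complex ^ 'n ^ 'n) \<Rightarrow> int \<Rightarrow> complex ^ 'n ^ 'n" where
  "mcoeff F k = (\<chi> i j. fourier_coeff (\<lambda>z. F z $ i $ j) k)"

lemma H2_vec_L2_vec: "h \<in> H2_vec \<Longrightarrow> h \<in> L2_vec"
  by (auto simp: H2_vec_def L2_vec_def H2_L2)

lemma L2_vecD: "h \<in> L2_vec \<Longrightarrow> (\<lambda>z. h z $ i) \<in> L2"
  by (simp add: L2_vec_def)

lemma Linfty_matD: "F \<in> Linfty_mat \<Longrightarrow> (\<lambda>z. F z $ i $ j) \<in> Linfty"
  by (simp add: Linfty_mat_def)

lemma L2_vec_mult: "F \<in> Linfty_mat \<Longrightarrow> h \<in> L2_vec \<Longrightarrow> (\<lambda>z. F z *v h z) \<in> L2_vec"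
  by (simp add: L2_vec_def Linfty_mat_def matrix_vector_mult_def L2_sum L2_Linfty_mult)

lemma L2_vec_diff: "f \<in> L2_vec \<Longrightarrow> g \<in> L2_vec \<Longrightarrow> (\<lambda>z. f z - g z) \<in> L2_vec"
  by (simp add: L2_vec_def L2_diff)

lemma L2_vec_const [simp]: "(\<lambda>z. v) \<in> L2_vec"
  by (simp add: L2_vec_def Linfty_L2)

lemma L2_vec_shift: "f \<in> L2_vec \<Longrightarrow> (\<lambda>z. z powi m *s f z) \<in> L2_vec"
  by (simp add: L2_vec_def L2_Linfty_mult)

lemma Linfty_mat_const [simp]: "(\<lambda>z. A) \<in> Linfty_mat"
  by (simp add: Linfty_mat_def)

lemma Linfty_mat_mult:
  "F \<in> Linfty_mat \<Longrightarrow> G \<in> Linfty_mat \<Longrightarrow> (\<lambda>z. F z ** G z) \<in> Linfty_mat"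
  by (simp add: Linfty_mat_def matrix_matrix_mult_def Linfty_sum Linfty_mult)

lemma Linfty_mat_diff:
  "F \<in> Linfty_mat \<Longrightarrow> G \<in> Linfty_mat \<Longrightarrow> (\<lambda>z. F z - G z) \<in> Linfty_mat"
  by (simp add: Linfty_mat_def Linfty_diff)

lemma Linfty_mat_ctransp: "F \<in> Linfty_mat \<Longrightarrow> (\<lambda>z. ctransp (F z)) \<in> Linfty_mat"
  by (simp add: Linfty_mat_def ctransp_def transpose_def map_matrix_def Linfty_cnj)

lemma vcoeff_diff:
  "f \<in> L2_vec \<Longrightarrow> g \<in> L2_vec \<Longrightarrow> vcoeff (\<lambda>z. f z - g z) k = vcoeff f k - vcoeff g k"
  by (simp add: vcoeff_def vec_eq_iff fourier_coeff_diff L2_integrable L2_vecD)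

lemma vcoeff_shift: "vcoeff (\<lambda>z. z powi m *s f z) k = vcoeff f (k - m)"
  by (simp add: vcoeff_def vec_eq_iff fourier_coeff_shift)

lemma fourier_coeff_const: "fourier_coeff (\<lambda>z. c) k = (if k = 0 then c else 0)"
  using fourier_coeff_cmult[of c "\<lambda>z. z powi 0" k] fourier_coeff_power_int[of 0 k] by simp

lemma vcoeff_const: "vcoeff (\<lambda>z. v) k = (if k = 0 then v else 0)"
  by (simp add: vcoeff_def vec_eq_iff fourier_coeff_const)

lemma vcoeff_matrix_mult:
  "f \<in> L2_vec \<Longrightarrow> vcoeff (\<lambda>z. A *v f z) k = A *v vcoeff f k"
  by (simp add: vcoeff_def vec_eq_iff matrix_vector_mult_def fourier_coeff_sum fourier_coeff_cmult
      L2_integrable L2_vecD)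

lemma vcoeff_mult_const:
  "F \<in> Linfty_mat \<Longrightarrow> vcoeff (\<lambda>z. F z *v v) k = mcoeff F k *v v"
  by (simp add: vcoeff_def mcoeff_def vec_eq_iff matrix_vector_mult_def fourier_coeff_sum fourier_coeff_mult_const
      L2_integrable Linfty_L2 Linfty_matD)

lemma mcoeff_diff:
  "F \<in> Linfty_mat \<Longrightarrow> G \<in> Linfty_mat \<Longrightarrow> mcoeff (\<lambda>z. F z - G z) k = mcoeff F k - mcoeff G k"
  by (simp add: mcoeff_def vec_eq_iff fourier_coeff_diff L2_integrable Linfty_L2 Linfty_matD)

lemma mcoeff_mult_const:
  "F \<in> Linfty_mat \<Longrightarrow> mcoeff (\<lambda>z. F z ** A) k = mcoeff F k ** A"
  by (simp add: mcoeff_def vec_eq_iff matrix_matrix_mult_def fourier_coeff_sum fourier_coeff_mult_const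
      L2_integrable Linfty_L2 Linfty_matD)

lemma mcoeff_const_mult:
  "F \<in> Linfty_mat \<Longrightarrow> mcoeff (\<lambda>z. A ** F z) k = A ** mcoeff F k"
  by (simp add: mcoeff_def vec_eq_iff matrix_matrix_mult_def fourier_coeff_sum fourier_coeff_cmult
      L2_integrable Linfty_L2 Linfty_matD)

lemma mcoeff_ctransp: "mcoeff (\<lambda>z. ctransp (F z)) k = ctransp (mcoeff F (- k))"
  by (simp add: mcoeff_def vec_eq_iff ctransp_def transpose_def map_matrix_def fourier_coeff_cnj)

lemma ctransp_ctransp [simp]: "ctransp (ctransp A) = A"
  by (simp add: vec_eq_iff ctransp_def transpose_def map_matrix_def)

lemma ctransp_mult: "ctransp (A ** B) = ctransp B ** ctransp A"
  by (simp add: vec_eq_iff ctransp_def transpose_def map_matrix_def matrix_matrix_mult_def mult.commute)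

section \<open>Passing between functions and their coefficients\<close>

lemma coanalytic_iff:
  assumes "F \<in> Linfty_mat"
  shows "coanalytic F \<longleftrightarrow> (\<forall>k>0. mcoeff F k = 0)"
  using assms by (auto simp: coanalytic_def mcoeff_def vec_eq_iff L2_integrable Linfty_L2 Linfty_matD)

lemma AE_vec_eq_iff:
  "(AE z in M. f z = g z) \<longleftrightarrow> (\<forall>i. AE z in M. f z $ i = (g z :: complex ^ 'n) $ i)"
  by (subst AE_all_countable[symmetric]) (auto simp: vec_eq_iff)

text \<open>Replaces almost everywhere identities by equations between coefficients; the nontrivial
  direction is the uniqueness theorem in each component.\<close>

lemma L2_vec_AE_eq_iff:
  assumes "f \<in> L2_vec" "g \<in> L2_vec"
  shows "(AE z in circle_measure. f z = g z) \<longleftrightarrow> (\<forall>k. vcoeff f k = vcoeff g k)"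
proof
  assume "AE z in circle_measure. f z = g z"
  then show "\<forall>k. vcoeff f k = vcoeff g k"
    unfolding AE_vec_eq_iff
    using assms
      by (auto intro!: fourier_coeff_cong_AE L2_measurable L2_vecD simp: vcoeff_def vec_eq_iff)
next
  assume "\<forall>k. vcoeff f k = vcoeff g k"
  then show "AE z in circle_measure. f z = g z"
    unfolding AE_vec_eq_iff
    using assms by (auto intro!: L2_AE_eqI L2_vecD simp: vcoeff_def vec_eq_iff)
qed

lemma H2_vec_iff: "h \<in> H2_vec \<longleftrightarrow> h \<in> L2_vec \<and> (\<forall>k<0. vcoeff h k = 0)"
  by (auto simp: H2_vec_def L2_vec_def H2_def vcoeff_def vec_eq_iff)

lemma H2_vec_shift: "h \<in> H2_vec \<Longrightarrow> m \<ge> 0 \<Longrightarrow> (\<lambda>z. z powi m *s h z) \<in> H2_vec"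
  by (simp add: H2_vec_iff L2_vec_shift vcoeff_shift)

lemma H2_vec_AE_eq_iff:
  assumes "f \<in> H2_vec" "g \<in> H2_vec"
  shows "(AE z in circle_measure. f z = g z) \<longleftrightarrow> (\<forall>k\<ge>0. vcoeff f k = vcoeff g k)"
  using L2_vec_AE_eq_iff[of f g] assms unfolding H2_vec_iff by (metis linorder_not_le)

lemma Linfty_mat_AE_eq_iff:
  assumes "F \<in> Linfty_mat" "G \<in> Linfty_mat"
  shows "(AE z in circle_measure. F z = G z) \<longleftrightarrow> (\<forall>k. mcoeff F k = mcoeff G k)"
proof -
  have "(AE z in circle_measure. F z = G z) \<longleftrightarrow> (\<forall>i. AE z in circle_measure. F z $ i = G z $ i)"
    by (subst AE_all_countable[symmetric]) (auto simp: vec_eq_iff)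
  also have "\<dots> \<longleftrightarrow> (\<forall>i k. vcoeff (\<lambda>z. F z $ i) k = vcoeff (\<lambda>z. G z $ i) k)"
    using assms by (subst L2_vec_AE_eq_iff) (auto simp: L2_vec_def Linfty_L2 Linfty_matD)
  also have "\<dots> \<longleftrightarrow> (\<forall>k. mcoeff F k = mcoeff G k)"
    by (auto simp: mcoeff_def vcoeff_def vec_eq_iff)
  finally show ?thesis .
qed

lemma vcoeff_cong_AE:
  assumes "f \<in> L2_vec" "g \<in> L2_vec" "AE z in circle_measure. f z = g z"
  shows "vcoeff f k = vcoeff g k"
  using assms L2_vec_AE_eq_iff by blast

text \<open>A co-analytic factor keeps a function within negative frequencies. Applied to
  \<open>\<phi> z - \<psi> z ** A\<close>, this removes a term under the projection.\<close>

lemma vcoeff_coanalytic_mult: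
  assumes "C \<in> Linfty_mat" "\<And>k. k > 0 \<Longrightarrow> mcoeff C k = 0"
    and "u \<in> L2_vec" "\<And>k. k \<ge> 0 \<Longrightarrow> vcoeff u k = 0" and "k \<ge> 0"
  shows "vcoeff (\<lambda>z. C z *v u z) k = 0"
proof -
  have "fourier_coeff (\<lambda>z. C z $ i $ j * u z $ j) k = 0" for i j
    using assms by (intro fourier_coeff_coanalytic_mult)
        (auto simp: Linfty_matD L2_vecD vcoeff_def mcoeff_def vec_eq_iff)
  then show ?thesis
    using assms by (simp add: vcoeff_def vec_eq_iff matrix_vector_mult_def fourier_coeff_sum
        L2_integrable L2_Linfty_mult Linfty_matD L2_vecD)
qed

text \<open>The analytic counterpart, applied later to
  \<open>ctransp (\<phi> z) - A ** \<psi> z\<close> and a function in \<open>H2_vec\<close>.\<close>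

lemma vcoeff_analytic_mult:
  assumes "C \<in> Linfty_mat" "\<And>k. k < 0 \<Longrightarrow> mcoeff C k = 0"
    and "u \<in> L2_vec" "\<And>k. k < 0 \<Longrightarrow> vcoeff u k = 0" and "k < 0"
  shows "vcoeff (\<lambda>z. C z *v u z) k = 0"
proof -
  have "fourier_coeff (\<lambda>z. C z $ i $ j * u z $ j) k = 0" for i j
    using assms by (intro fourier_coeff_analytic_mult[where p=0])
        (auto simp: Linfty_matD L2_vecD vcoeff_def mcoeff_def vec_eq_iff)
  then show ?thesis
    using assms by (simp add: vcoeff_def vec_eq_iff matrix_vector_mult_def fourier_coeff_sum
        L2_integrable L2_Linfty_mult Linfty_matD L2_vecD)
qed

section \<open>Projections and Toeplitz operators in terms of coefficients\<close>

lemma proj_vec_H2_vec: "f \<in> L2_vec \<Longrightarrow> proj_vec f \<in> H2_vec"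
  unfolding H2_vec_def L2_vec_def proj_vec_def by (simp add: riesz_proj_H2)

lemma vcoeff_proj_vec: "f \<in> L2_vec \<Longrightarrow> k \<ge> 0 \<Longrightarrow> vcoeff (proj_vec f) k = vcoeff f k"
  unfolding vcoeff_def L2_vec_def proj_vec_def by (simp add: fourier_coeff_riesz_proj)

definition coproj_vec :: "(complex \<Rightarrow> complex ^ 'n) \<Rightarrow> complex \<Rightarrow> complex ^ 'n" where
  "coproj_vec f z = f z - proj_vec f z"

lemma coproj_vec_L2_vec: "f \<in> L2_vec \<Longrightarrow> coproj_vec f \<in> L2_vec"
  unfolding coproj_vec_def[abs_def] by (simp add: L2_vec_diff H2_vec_L2_vec proj_vec_H2_vec)

lemma vcoeff_coproj_vec:
  assumes "f \<in> L2_vec"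
  shows "vcoeff (coproj_vec f) k = (if k < 0 then vcoeff f k else 0)"
  using assms proj_vec_H2_vec[OF assms] unfolding coproj_vec_def[abs_def]
  by (subst vcoeff_diff) (auto simp: vcoeff_proj_vec H2_vec_iff)

lemma toeplitz_H2_vec: "F \<in> Linfty_mat \<Longrightarrow> h \<in> H2_vec \<Longrightarrow> toeplitz F h \<in> H2_vec"
  unfolding toeplitz_def by (intro proj_vec_H2_vec L2_vec_mult H2_vec_L2_vec)

lemma vcoeff_toeplitz:
  "F \<in> Linfty_mat \<Longrightarrow> h \<in> H2_vec \<Longrightarrow> k \<ge> 0 \<Longrightarrow> vcoeff (toeplitz F h) k = vcoeff (\<lambda>z. F z *v h z) k"
  unfolding toeplitz_def by (intro vcoeff_proj_vec L2_vec_mult H2_vec_L2_vec)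

text \<open>Writing the inner projection as identity minus \<open>coproj_vec\<close> isolates the
  failure of multiplicativity in the second term.\<close>

lemma vcoeff_toeplitz_toeplitz:
  assumes "F \<in> Linfty_mat" "G \<in> Linfty_mat" "h \<in> H2_vec" "k \<ge> 0"
  shows "vcoeff (toeplitz F (toeplitz G h)) k
    = vcoeff (\<lambda>z. F z *v (G z *v h z)) k - vcoeff (\<lambda>z. F z *v coproj_vec (\<lambda>z. G z *v h z) z) k"
proof -
  have Gh: "(\<lambda>z. G z *v h z) \<in> L2_vec" using assms by (intro L2_vec_mult H2_vec_L2_vec)
  have "vcoeff (toeplitz F (toeplitz G h)) k = vcoeff (\<lambda>z. F z *v toeplitz G h z) k"
    using assms by (simp add: vcoeff_toeplitz toeplitz_H2_vec)
  also have "\<dots> = vcoeff (\<lambda>z. F z *v (G z *v h z) - F z *v coproj_vec (\<lambda>z. G z *v h z) z) k"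
    by (simp add: coproj_vec_def toeplitz_def matrix_vector_mult_diff_distrib)
  finally show ?thesis
    using assms Gh by (simp add: vcoeff_diff L2_vec_mult coproj_vec_L2_vec)
qed

section \<open>The adjoint of a Toeplitz operator\<close>

lemma L2_inner_cnj: "cnj (L2_inner f g) = L2_inner g f"
  unfolding L2_inner_def Bochner_Integration.integral_cnj[symmetric] by (simp add: mult.commute)

lemma L2_inner_diff_left:
  "f \<in> L2 \<Longrightarrow> g \<in> L2 \<Longrightarrow> h \<in> L2 \<Longrightarrow> L2_inner (\<lambda>z. f z - g z) h = L2_inner f h - L2_inner g h"
  unfolding L2_inner_def
  by (simp add: left_diff_distrib L2_mult_integrable L2_cnj)

lemma L2_inner_riesz_proj_left:
  assumes "f \<in> L2" "h \<in> H2" shows "L2_inner (riesz_proj f) h = L2_inner f h"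
  using L2_inner_riesz_proj[OF assms] assms
  by (simp add: L2_inner_diff_left riesz_proj_H2 H2_L2)

text \<open>Each projection may be dropped because the other argument of the inner product lies in
  \<open>H2_vec\<close>. What remains is the pointwise adjoint relation of matrices.\<close>

lemma H2_vec_inner_toeplitz:
  assumes F: "F \<in> Linfty_mat" and h: "h \<in> H2_vec" and k: "k \<in> H2_vec"
  shows "H2_vec_inner (toeplitz F k) h = H2_vec_inner k (toeplitz (\<lambda>z. ctransp (F z)) h)"
proof -
  have L: "(\<lambda>z. (F z *v k z) $ i) \<in> L2" "(\<lambda>z. (ctransp (F z) *v h z) $ i) \<in> L2" for i
    by (rule L2_vecD[OF L2_vec_mult[OF F H2_vec_L2_vec[OF k]]],
        rule L2_vecD[OF L2_vec_mult[OF Linfty_mat_ctransp[OF F] H2_vec_L2_vec[OF h]]])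
  have H: "(\<lambda>z. h z $ i) \<in> H2" "(\<lambda>z. k z $ i) \<in> H2" for i using h k by (auto simp: H2_vec_def)
  have I: "integrable circle_measure (\<lambda>z. F z $ i $ j * k z $ j * cnj (h z $ i))" for i j
    using F H by (intro L2_mult_integrable L2_Linfty_mult L2_cnj H2_L2 Linfty_matD) auto
  have "H2_vec_inner (toeplitz F k) h = (\<Sum>i\<in>UNIV. L2_inner (\<lambda>z. (F z *v k z) $ i) (\<lambda>z. h z $ i))"
    unfolding H2_vec_inner_def toeplitz_def proj_vec_def
    by (simp add: L2_inner_riesz_proj_left L H)
  also have "\<dots> = (\<Sum>i\<in>UNIV. \<Sum>j\<in>UNIV. LINT z|circle_measure. F z $ i $ j * k z $ j * cnj (h z $ i))"
    unfolding L2_inner_def using I by (simp add: matrix_vector_mult_def sum_distrib_right)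
  also have "\<dots> = (\<Sum>j\<in>UNIV. \<Sum>i\<in>UNIV. LINT z|circle_measure. F z $ i $ j * k z $ j * cnj (h z $ i))"
    by (rule sum.swap)
  also have "\<dots> = (\<Sum>j\<in>UNIV. L2_inner (\<lambda>z. k z $ j) (\<lambda>z. (ctransp (F z) *v h z) $ j))"
  proof (intro sum.cong refl)
    fix j
    have "L2_inner (\<lambda>z. k z $ j) (\<lambda>z. (ctransp (F z) *v h z) $ j)
        = (LINT z|circle_measure. (\<Sum>i\<in>UNIV. F z $ i $ j * k z $ j * cnj (h z $ i)))"
      unfolding L2_inner_def
      by (intro Bochner_Integration.integral_cong refl)
         (simp add: matrix_vector_mult_def
             sum_distrib_left ctransp_def transpose_def map_matrix_def mult_ac)
    also have "\<dots> = (\<Sum>i\<in>UNIV. LINT z|circle_measure. F z $ i $ j * k z $ j * cnj (h z $ i))"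
      by (rule Bochner_Integration.integral_sum) (rule I)
    finally show "(\<Sum>i\<in>UNIV. LINT z|circle_measure. F z $ i $ j * k z $ j * cnj (h z $ i))
        = L2_inner (\<lambda>z. k z $ j) (\<lambda>z. (ctransp (F z) *v h z) $ j)" by simp
  qed
  also have "\<dots> = H2_vec_inner k (toeplitz (\<lambda>z. ctransp (F z)) h)"
    unfolding H2_vec_inner_def toeplitz_def proj_vec_def
    \<comment> \<open>Conjugate symmetry moves the projection to the first argument, where it can be
      removed.\<close>
    by (subst (1 2) L2_inner_cnj[symmetric]) (simp add: L2_inner_riesz_proj_left L H)
  finally show ?thesis .
qed

lemma H2_vec_monomial: "m \<ge> 0 \<Longrightarrow> (\<lambda>z. z powi m *s v) \<in> H2_vec"
  by (rule H2_vec_shift) (simp_all add: H2_vec_iff vcoeff_const)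

lemma H2_vec_inner_monomial:
  "H2_vec_inner (\<lambda>z. z powi m *s axis i 1) g = cnj (vcoeff g m $ i)"
proof -
  have "H2_vec_inner (\<lambda>z. z powi m *s axis i 1) g
      = (\<Sum>j\<in>UNIV. if j = i then L2_inner (\<lambda>z. z powi m) (\<lambda>z. g z $ j) else 0)"
    unfolding H2_vec_inner_def by (intro sum.cong refl) (auto simp: axis_def L2_inner_def)
  also have "\<dots> = cnj (vcoeff g m $ i)"
    by (simp add: vcoeff_def flip: L2_inner_power_int L2_inner_cnj[of "\<lambda>z. g z $ i"])
  finally show ?thesis .
qed

text \<open>The Toeplitz operator of the pointwise adjoint satisfies the property that defines the
  choice. Any chosen representative agrees with it when tested against monomials, hence in all
  nonnegative coefficients.\<close>

lemma op_adjoint_toeplitz: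
  assumes F: "F \<in> Linfty_mat" and h: "h \<in> H2_vec"
  shows "op_adjoint (toeplitz F) h \<in> H2_vec"
    and "AE z in circle_measure. op_adjoint (toeplitz F) h z = toeplitz (\<lambda>z. ctransp (F z)) h z"
proof -
  let ?g = "toeplitz (\<lambda>z. ctransp (F z)) h"
  have g: "?g \<in> H2_vec" by (intro toeplitz_H2_vec Linfty_mat_ctransp F h)
  have "\<exists>g. g \<in> H2_vec \<and> (\<forall>k\<in>H2_vec. H2_vec_inner (toeplitz F k) h = H2_vec_inner k g)"
    using g H2_vec_inner_toeplitz[OF F h] by blast
  from someI_ex[OF this]
  have a: "op_adjoint (toeplitz F) h \<in> H2_vec"
    "\<And>k. k \<in> H2_vec \<Longrightarrow> H2_vec_inner (toeplitz F k) h = H2_vec_inner k (op_adjoint (toeplitz F) h)"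
    unfolding op_adjoint_def by blast+
  then show "op_adjoint (toeplitz F) h \<in> H2_vec" by blast
  have "vcoeff (op_adjoint (toeplitz F) h) m $ i = vcoeff ?g m $ i" if "m \<ge> 0" for m i
    using a(2)[OF H2_vec_monomial[OF that]] H2_vec_inner_toeplitz[OF F h H2_vec_monomial[OF that], of "axis i 1"]
    by (metis H2_vec_inner_monomial complex_cnj_cancel_iff)
  then show "AE z in circle_measure. op_adjoint (toeplitz F) h z = ?g z"
    unfolding H2_vec_AE_eq_iff[OF a(1) g] by (simp add: vec_eq_iff)
qed

text \<open>The chosen adjoint is known only up to a null set; the outer Toeplitz operator does not
  see the difference.\<close>

lemma vcoeff_toeplitz_adjoint:
  assumes "F \<in> Linfty_mat" "G \<in> Linfty_mat" "h \<in> H2_vec" "k \<ge> 0"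
  shows "vcoeff (toeplitz G (op_adjoint (toeplitz F) h)) k
      = vcoeff (toeplitz G (toeplitz (\<lambda>z. ctransp (F z)) h)) k"
proof -
  note a = op_adjoint_toeplitz[OF assms(1,3)]
  have g: "toeplitz (\<lambda>z. ctransp (F z)) h \<in> H2_vec" by (intro toeplitz_H2_vec Linfty_mat_ctransp assms)
  have "vcoeff (\<lambda>z. G z *v op_adjoint (toeplitz F) h z) k
      = vcoeff (\<lambda>z. G z *v toeplitz (\<lambda>z. ctransp (F z)) h z) k"
    using a(2) by (intro vcoeff_cong_AE L2_vec_mult H2_vec_L2_vec a(1) g assms(2)) auto
  then show ?thesis using a(1) g assms by (simp add: vcoeff_toeplitz)
qed

lemma H2_op_eq_iff:
  assumes \<phi>: "\<phi> \<in> Linfty_mat" and \<psi>: "\<psi> \<in> Linfty_mat"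
  shows "H2_op_eq (toeplitz \<phi> \<circ> toeplitz \<psi>) (toeplitz \<psi> \<circ> op_adjoint (toeplitz \<phi>)) \<longleftrightarrow>
    (\<forall>h\<in>H2_vec. \<forall>k\<ge>0. vcoeff (toeplitz \<phi> (toeplitz \<psi> h)) k
        = vcoeff (toeplitz \<psi> (toeplitz (\<lambda>z. ctransp (\<phi> z)) h)) k)"
proof -
  have "(AE z in circle_measure. toeplitz \<phi> (toeplitz \<psi> h) z
      = toeplitz \<psi> (op_adjoint (toeplitz \<phi>) h) z) \<longleftrightarrow>
    (\<forall>k\<ge>0. vcoeff (toeplitz \<phi> (toeplitz \<psi> h)) k
        = vcoeff (toeplitz \<psi> (toeplitz (\<lambda>z. ctransp (\<phi> z)) h)) k)"
    if h: "h \<in> H2_vec" for h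
    using assms h op_adjoint_toeplitz(1)[OF \<phi> h]
    by (subst H2_vec_AE_eq_iff) (auto simp: toeplitz_H2_vec vcoeff_toeplitz_adjoint)
  then show ?thesis by (simp add: H2_op_eq_def)
qed

text \<open>In terms of the block matrices of Toeplitz operators: \<open>T\<^sub>F T\<^sub>G\<close> deviates from being
  constant along diagonals by the product of a positive coefficient of \<open>F\<close> and a negative one of \<open>G\<close>.\<close>

lemma vcoeff_toeplitz_toeplitz_shift:
  assumes F: "F \<in> Linfty_mat" and G: "G \<in> Linfty_mat" and h: "h \<in> H2_vec" and k: "k \<ge> 0"
  shows "vcoeff (toeplitz F (toeplitz G (\<lambda>z. z powi 1 *s h z))) (k + 1)
    = vcoeff (toeplitz F (toeplitz G h)) k + mcoeff F (k + 1) *v vcoeff (\<lambda>z. G z *v h z) (- 1)"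
proof -
  let ?g = "\<lambda>z. G z *v h z"
  let ?c = "vcoeff ?g (- 1)"
  have g: "?g \<in> L2_vec" using G h by (intro L2_vec_mult H2_vec_L2_vec)
  have zh: "(\<lambda>z. z powi 1 *s h z) \<in> H2_vec" using h by (intro H2_vec_shift) auto
  have Gz: "G z *v (z powi 1 *s h z) = z powi 1 *s ?g z" for z
    by (rule vector_scalar_commute)
  have Fz: "F z *v (z powi 1 *s v) = z powi 1 *s (F z *v v)" for z v
    by (rule vector_scalar_commute)
  note zg = L2_vec_shift[OF g, of 1] and Q = coproj_vec_L2_vec[OF g]
  \<comment> \<open>Multiplication by \<open>z\<close> moves the coefficient of index -1 to index 0,
    where \<open>coproj_vec\<close> discards it; this is the correction \<open>?c\<close>.\<close>
  have "AE z in circle_measure. coproj_vec (\<lambda>z. z powi 1 *s ?g z) z = z powi 1 *s coproj_vec ?g z - ?c"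
    using coproj_vec_L2_vec[OF zg] L2_vec_diff[OF L2_vec_shift[OF Q, of 1] L2_vec_const[of ?c]]
    by (subst L2_vec_AE_eq_iff)
       (auto simp: vcoeff_diff L2_vec_shift Q vcoeff_coproj_vec[OF zg] vcoeff_shift vcoeff_coproj_vec[OF g] vcoeff_const
          simp del: power_int_1_right)
  then have "vcoeff (\<lambda>z. F z *v coproj_vec (\<lambda>z. z powi 1 *s ?g z) z) (k + 1)
      = vcoeff (\<lambda>z. F z *v (z powi 1 *s coproj_vec ?g z - ?c)) (k + 1)"
    by (intro vcoeff_cong_AE L2_vec_mult F coproj_vec_L2_vec zg L2_vec_diff L2_vec_shift Q L2_vec_const) auto
  also have "\<dots> = vcoeff (\<lambda>z. z powi 1 *s (F z *v coproj_vec ?g z) - F z *v ?c) (k + 1)"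
    by (simp only: matrix_vector_mult_diff_distrib Fz)
  also have "\<dots> = vcoeff (\<lambda>z. F z *v coproj_vec ?g z) k - mcoeff F (k + 1) *v ?c"
    by (subst vcoeff_diff)
        (simp_all only: L2_vec_shift L2_vec_mult F Q L2_vec_const vcoeff_shift vcoeff_mult_const, simp)
  finally have *: "vcoeff (\<lambda>z. F z *v coproj_vec (\<lambda>z. z powi 1 *s ?g z) z) (k + 1)
      = vcoeff (\<lambda>z. F z *v coproj_vec ?g z) k - mcoeff F (k + 1) *v ?c" .
  have **: "vcoeff (\<lambda>z. F z *v (z powi 1 *s ?g z)) (k + 1) = vcoeff (\<lambda>z. F z *v ?g z) k"
    unfolding Fz vcoeff_shift by simp
  show ?thesis
    using k
      by (simp only: vcoeff_toeplitz_toeplitz[OF F G zh] vcoeff_toeplitz_toeplitz[OF F G h] Gz * **) simp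
qed

section \<open>The intertwining relation\<close>


lemma inner_matrix_vector_mult_ctransp:
  fixes M :: "complex ^ 'n ^ 'n"
  shows "w \<bullet> (M *v y) = (ctransp M *v w) \<bullet> y"
proof -
  \<comment> \<open>The real inner product is the real part of the Hermitian one, so a factor moved
    across it is conjugated.\<close>
  have c: "a \<bullet> (b * c) = (cnj b * a) \<bullet> c" for a b c :: complex
    by (simp add: inner_complex_def algebra_simps)
  have "w \<bullet> (M *v y) = (\<Sum>i\<in>UNIV. \<Sum>j\<in>UNIV. (cnj (M $ i $ j) * w $ i) \<bullet> y $ j)"
    by (simp add: inner_vec_def matrix_vector_mult_def inner_sum_right c)
  also have "\<dots> = (\<Sum>j\<in>UNIV. \<Sum>i\<in>UNIV. (cnj (M $ i $ j) * w $ i) \<bullet> y $ j)"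
    by (rule sum.swap)
  also have "\<dots> = (ctransp M *v w) \<bullet> y"
    by (simp add: inner_vec_def matrix_vector_mult_def inner_sum_left ctransp_def transpose_def map_matrix_def)
  finally show ?thesis .
qed

text \<open>A proper subspace has a nonzero orthogonal vector \<open>w\<close>. Testing
  \<open>w\<close> against the image under \<open>d i\<close> of \<open>ctransp (d i) *v w\<close>
  shows that the latter has norm 0, which contradicts the trivial common kernel.\<close>

lemma subspace_eq_UNIV_if_orthogonal:
  fixes S :: "(complex ^ 'n) set" and d :: "'i \<Rightarrow> complex ^ 'n ^ 'n"
  assumes S: "subspace S" and d: "\<And>i v. i \<in> I \<Longrightarrow> d i *v v \<in> S"
    and ker: "\<And>w. (\<And>i. i \<in> I \<Longrightarrow> ctransp (d i) *v w = 0) \<Longrightarrow> w = 0"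
  shows "S = UNIV"
proof (rule ccontr)
  assume "S \<noteq> UNIV"
  then have "span S \<noteq> UNIV" using S by (simp add: span_eq_iff[THEN iffD2])
  then obtain w where w: "w \<noteq> 0" "\<And>x. x \<in> span S \<Longrightarrow> w \<bullet> x = 0"
    using span_not_UNIV_orthogonal by blast
  have "ctransp (d i) *v w = 0" if "i \<in> I" for i
    using w(2)[OF span_base[OF d[OF that]], of "ctransp (d i) *v w"]
    by (simp add: inner_matrix_vector_mult_ctransp[of w "d i"])
  with ker w(1) show False by blast
qed

lemma matrix_eqI_mult_vec: "(\<And>v. M *v v = N *v v) \<Longrightarrow> M = (N :: complex ^ 'n ^ 'n)"
  by (simp add: matrix_eq)

lemma matrix_vector_mult_axis: "M *v axis k 1 = column k (M :: complex ^ 'n ^ 'n)"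
  by (simp add: vec_eq_iff matrix_vector_mult_def axis_def column_def if_distrib cong: if_cong)

text \<open>
  The vectors \<open>v\<close> for which some \<open>u\<close> solves all the equations \<open>a\<^sub>i v = b\<^sub>i u\<close> form a subspace containing
  the ranges of the \<open>d\<^sub>j\<close>; solutions \<open>u\<close> for the basis vectors are the columns of \<open>A\<close>.
\<close>

lemma common_factor_matrix:
  fixes a b c d :: "'i \<Rightarrow> complex ^ 'n ^ 'n"
  assumes eq: "\<And>i j. i \<in> I \<Longrightarrow> j \<in> I \<Longrightarrow> a i ** d j = b i ** c j"
    and kerb: "\<And>v. (\<And>i. i \<in> I \<Longrightarrow> b i *v v = 0) \<Longrightarrow> v = 0"
    and kerd: "\<And>w. (\<And>i. i \<in> I \<Longrightarrow> ctransp (d i) *v w = 0) \<Longrightarrow> w = 0"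
  obtains A where "\<And>i. i \<in> I \<Longrightarrow> a i = b i ** A" "\<And>j. j \<in> I \<Longrightarrow> c j = A ** d j"
proof -
  let ?S = "{v. \<exists>u. \<forall>i\<in>I. a i *v v = b i *v u}"
  have scaleR: "M *v (r *\<^sub>R x) = r *\<^sub>R (M *v x)" for M :: "complex ^ 'n ^ 'n" and r :: real and x
    by (simp add: vec_eq_iff matrix_vector_mult_def scaleR_sum_right)
  have "subspace ?S"
  proof (rule subspaceI)
    show "0 \<in> ?S" by (auto intro!: exI[of _ 0])
  next
    fix x y assume "x \<in> ?S" "y \<in> ?S"
    then obtain u v where "\<forall>i\<in>I. a i *v x = b i *v u" "\<forall>i\<in>I. a i *v y = b i *v v" by blast
    then show "x + y \<in> ?S" by (auto intro!: exI[of _ "u + v"] simp: matrix_vector_right_distrib)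
  next
    fix x and r :: real assume "x \<in> ?S"
    then obtain u where "\<forall>i\<in>I. a i *v x = b i *v u" by blast
    then show "r *\<^sub>R x \<in> ?S" by (auto intro!: exI[of _ "r *\<^sub>R u"] simp: scaleR)
  qed
  \<comment> \<open>The witness \<open>c j *v v\<close> is the hypothesis \<open>eq\<close> read as
    a solution.\<close>
  moreover have "d j *v v \<in> ?S" if "j \<in> I" for j v
    using eq that by (auto intro!: exI[of _ "c j *v v"] simp: matrix_vector_mul_assoc)
  ultimately have "?S = UNIV" by (rule subspace_eq_UNIV_if_orthogonal[where d=d and I=I])
      (auto intro: kerd)
  then have "\<forall>k. \<exists>u. \<forall>i\<in>I. a i *v axis k 1 = b i *v u" by blast
  then obtain u where u: "\<And>k i. i \<in> I \<Longrightarrow> a i *v axis k 1 = b i *v u k" by metis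
  define A where "A = (\<chi> i j. u j $ i)"
  have colA: "column k A = u k" for k by (simp add: A_def column_def vec_eq_iff)
  have A1: "a i = b i ** A" if "i \<in> I" for i
  proof -
    have "column k (a i) = column k (b i ** A)" for k
      using u[OF that, of k] colA[of k]
      by (metis matrix_vector_mult_axis matrix_vector_mul_assoc)
    then show ?thesis by (simp add: vec_eq_iff column_def)
  qed
  have A2: "c j = A ** d j" if "j \<in> I" for j
  proof (rule matrix_eqI_mult_vec)
    fix v
    \<comment> \<open>Both terms have the same image under every \<open>b i\<close>, since
      \<open>b i ** c j = a i ** d j = b i ** A ** d j\<close>; the common kernel of the
      \<open>b i\<close> is trivial.\<close>
    have "b i *v (c j *v v - (A ** d j) *v v) = 0" if "i \<in> I" for i
      using eq[OF \<open>i \<in> I\<close> \<open>j \<in> I\<close>] A1[OF \<open>i \<in> I\<close>]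
      by (simp add: matrix_vector_mult_diff_distrib matrix_vector_mul_assoc matrix_mul_assoc)
    then have "c j *v v - (A ** d j) *v v = 0" by (rule kerb)
    then show "c j *v v = (A ** d j) *v v" by simp
  qed
  show ?thesis using that A1 A2 by blast
qed

text \<open>The factor \<open>cnj z\<close> moves index 1 to index 0, so the projection keeps
  exactly the strictly positive coefficients of \<open>F\<close>. A common kernel vector
  \<open>v\<close> of these gives a linear relation between the columns with constants
  \<open>v $ j\<close>, which regularity forces to be trivial.\<close>

lemma regular_proj_mat_ker:
  assumes F: "F \<in> Linfty_mat"
    and reg: "regular (proj_mat (\<lambda>z. map_matrix (\<lambda>a. cnj z * a) (F z)))"
    and v: "\<And>k. k > 0 \<Longrightarrow> mcoeff F k *v v = 0"
  shows "v = 0"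
proof -
  have L: "(\<lambda>z. cnj z * F z $ i $ j) \<in> L2" for i j
  proof -
    have "cnj \<in> Linfty" using Linfty_cnj[OF Linfty_power_int[of 1]] by simp
    then show ?thesis using F by (intro L2_Linfty_mult Linfty_L2 Linfty_matD) auto
  qed
  have c: "fourier_coeff (\<lambda>z. cnj z * F z $ i $ j) k
      = fourier_coeff (\<lambda>z. F z $ i $ j) (k + 1)" for i j k
  proof -
    have "fourier_coeff (\<lambda>z. cnj z * F z $ i $ j) k = fourier_coeff (\<lambda>z. z powi (- 1) * F z $ i $ j) k"
      by (rule fourier_coeff_cong) (simp add: cnj_circle)
    then show ?thesis by (simp only: fourier_coeff_shift) simp
  qed
  let ?R = "\<lambda>i j. riesz_proj (\<lambda>w. cnj w * F w $ i $ j)"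
  let ?s = "\<lambda>z. \<Sum>j\<in>UNIV. v $ j *s column j (proj_mat (\<lambda>z. map_matrix (\<lambda>a. cnj z * a) (F z)) z)"
  have s: "?s z $ i = (\<Sum>j\<in>UNIV. v $ j * ?R i j z)" for z i
    by (simp add: column_def proj_mat_def map_matrix_def)
  have R: "?R i j \<in> H2" for i j using L by (rule riesz_proj_H2)
  have "vcoeff ?s k = 0" for k
  proof -
    have "fourier_coeff (\<lambda>z. \<Sum>j\<in>UNIV. v $ j * ?R i j z) k = 0" for i
    proof -
      have "fourier_coeff (\<lambda>z. \<Sum>j\<in>UNIV. v $ j * ?R i j z) k
          = (\<Sum>j\<in>UNIV. v $ j * fourier_coeff (?R i j) k)"
        using R by (subst fourier_coeff_sum) (auto simp: fourier_coeff_cmult L2_integrable H2_L2)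
      also have "\<dots> = 0"
      proof (cases "k < 0")
        case True
        then show ?thesis using R by (simp add: H2_fourier_coeff_neg)
      next
        case False
        then have "(\<Sum>j\<in>UNIV. v $ j * fourier_coeff (?R i j) k) = (mcoeff F (k + 1) *v v) $ i"
          by (simp add: fourier_coeff_riesz_proj L c mcoeff_def matrix_vector_mult_def mult.commute)
        then show ?thesis using v[of "k + 1"] False by simp
      qed
      finally show ?thesis .
    qed
    then show ?thesis unfolding vcoeff_def s by (simp add: vec_eq_iff)
  qed
  moreover have "?s \<in> L2_vec"
  proof -
    have "(\<lambda>z. ?s z $ i) \<in> L2" for i
      unfolding s using R by (intro L2_sum L2_cmult H2_L2)
    then show ?thesis unfolding L2_vec_def by blast
  qed
  ultimately have "AE z in circle_measure. ?s z = 0"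
    by (subst L2_vec_AE_eq_iff) (simp_all add: vcoeff_const)
  then have "\<forall>j. v $ j = 0" using reg unfolding regular_def by blast
  then show ?thesis by (simp add: vec_eq_iff)
qed

text \<open>The operator identity is used for \<open>?h\<close> and for \<open>z\<close> times
  \<open>?h\<close>. Subtracting the two shift formulas leaves only their correction terms.\<close>

lemma toeplitz_intertwining_coeffs:
  fixes \<phi> \<psi> :: "complex \<Rightarrow> complex ^ 'n ^ 'n"
  assumes \<phi>: "\<phi> \<in> Linfty_mat" and \<psi>: "\<psi> \<in> Linfty_mat"
    and eq: "\<And>h k. h \<in> H2_vec \<Longrightarrow> k \<ge> 0 \<Longrightarrow>
      vcoeff (toeplitz \<phi> (toeplitz \<psi> h)) k = vcoeff (toeplitz \<psi> (toeplitz (\<lambda>z. ctransp (\<phi> z)) h)) k"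
    and "i > 0" "j > 0"
  shows "mcoeff \<phi> i ** mcoeff \<psi> (- j) = mcoeff \<psi> i ** ctransp (mcoeff \<phi> j)"
proof (rule matrix_eqI_mult_vec)
  fix v :: "complex ^ 'n"
  \<comment> \<open>The exponent \<open>j - 1\<close> turns the coefficient of index -1 in the
    correction term into the symbol's coefficient of index \<open>- j\<close>.\<close>
  let ?h = "\<lambda>z. z powi (j - 1) *s v"
  have h: "?h \<in> H2_vec" using \<open>j > 0\<close> by (intro H2_vec_monomial) auto
  then have zh: "(\<lambda>z. z powi 1 *s ?h z) \<in> H2_vec" by (rule H2_vec_shift) simp
  have \<phi>': "(\<lambda>z. ctransp (\<phi> z)) \<in> Linfty_mat" by (rule Linfty_mat_ctransp[OF \<phi>])
  have i: "i - 1 \<ge> 0" using \<open>i > 0\<close> by simp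
  have *: "vcoeff (\<lambda>z. F z *v ?h z) (- 1) = mcoeff F (- j) *v v" if "F \<in> Linfty_mat" for F
    using that by (simp add: vector_scalar_commute vcoeff_shift vcoeff_mult_const)
  have "mcoeff \<phi> i *v vcoeff (\<lambda>z. \<psi> z *v ?h z) (- 1)
      = mcoeff \<psi> i *v vcoeff (\<lambda>z. ctransp (\<phi> z) *v ?h z) (- 1)"
    using vcoeff_toeplitz_toeplitz_shift[OF \<phi> \<psi> h i] vcoeff_toeplitz_toeplitz_shift[OF \<psi> \<phi>' h i]
      eq[OF zh, of i] eq[OF h i] \<open>i > 0\<close> by simp
  then show "(mcoeff \<phi> i ** mcoeff \<psi> (- j)) *v v = (mcoeff \<psi> i ** ctransp (mcoeff \<phi> j)) *v v"
    by (simp add: * \<psi> \<phi>' mcoeff_ctransp matrix_vector_mul_assoc)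
qed

text \<open>\<open>A1\<close> makes \<open>\<phi> z - \<psi> z ** A\<close> co-analytic, so
  \<open>\<phi>\<close> may be replaced by \<open>\<psi> z ** A\<close> in front of
  \<open>?Q\<close>. \<open>A2\<close> makes \<open>ctransp (\<phi> z) - A ** \<psi> z\<close>
  analytic, so \<open>A\<close> carries \<open>?Q\<close> to the other negative part.\<close>

lemma vcoeff_coproj_exchange:
  assumes \<phi>: "\<phi> \<in> Linfty_mat" and \<psi>: "\<psi> \<in> Linfty_mat"
    and A1: "\<And>k. k > 0 \<Longrightarrow> mcoeff \<phi> k = mcoeff \<psi> k ** A"
    and A2: "\<And>k. k > 0 \<Longrightarrow> ctransp (mcoeff \<phi> k) = A ** mcoeff \<psi> (- k)"
    and h: "h \<in> H2_vec" and k: "k \<ge> 0"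
  shows "vcoeff (\<lambda>z. \<phi> z *v coproj_vec (\<lambda>z. \<psi> z *v h z) z) k
       = vcoeff (\<lambda>z. \<psi> z *v coproj_vec (\<lambda>z. ctransp (\<phi> z) *v h z) z) k"
proof -
  have \<phi>': "(\<lambda>z. ctransp (\<phi> z)) \<in> Linfty_mat" by (rule Linfty_mat_ctransp[OF \<phi>])
  have \<psi>h: "(\<lambda>z. \<psi> z *v h z) \<in> L2_vec" and \<phi>h: "(\<lambda>z. ctransp (\<phi> z) *v h z) \<in> L2_vec"
    using h by (auto intro: L2_vec_mult \<psi> \<phi>' H2_vec_L2_vec)
  let ?Q = "coproj_vec (\<lambda>z. \<psi> z *v h z)"
  note Q = coproj_vec_L2_vec[OF \<psi>h]
  have AQ: "(\<lambda>z. A *v ?Q z) \<in> L2_vec" by (rule L2_vec_mult[OF Linfty_mat_const Q])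
  have C: "(\<lambda>z. \<phi> z - \<psi> z ** A) \<in> Linfty_mat"
    by (intro Linfty_mat_diff Linfty_mat_mult \<phi> \<psi> Linfty_mat_const)
  have "vcoeff (\<lambda>z. (\<phi> z - \<psi> z ** A) *v ?Q z) k = 0"
    by (rule vcoeff_coanalytic_mult[OF C _ Q _ k])
       (simp_all add: mcoeff_diff mcoeff_mult_const Linfty_mat_mult \<phi> \<psi> A1 vcoeff_coproj_vec[OF \<psi>h])
  then have 1: "vcoeff (\<lambda>z. \<phi> z *v ?Q z) k = vcoeff (\<lambda>z. \<psi> z *v (A *v ?Q z)) k"
    by (simp add: matrix_vector_mult_diff_rdistrib vcoeff_diff L2_vec_mult Q \<phi> \<psi> Linfty_mat_mult AQ
        flip: matrix_vector_mul_assoc)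
  have B: "(\<lambda>z. ctransp (\<phi> z) - A ** \<psi> z) \<in> Linfty_mat"
    by (intro Linfty_mat_diff Linfty_mat_mult \<phi>' \<psi> Linfty_mat_const)
  have A\<psi>h: "(\<lambda>z. A *v (\<psi> z *v h z)) \<in> L2_vec" by (rule L2_vec_mult[OF Linfty_mat_const \<psi>h])
  have neg: "vcoeff (\<lambda>z. ctransp (\<phi> z) *v h z) m = A *v vcoeff (\<lambda>z. \<psi> z *v h z) m" if "m < 0" for m
  proof -
    have "mcoeff (\<lambda>z. ctransp (\<phi> z) - A ** \<psi> z) n = 0" if "n < 0" for n
      using A2[of "- n"] that
        by (simp add: mcoeff_diff mcoeff_const_mult Linfty_mat_mult \<phi>' \<psi> mcoeff_ctransp)
    then have "vcoeff (\<lambda>z. (ctransp (\<phi> z) - A ** \<psi> z) *v h z) m = 0"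
      using h that by (intro vcoeff_analytic_mult[OF B]) (auto simp: H2_vec_iff)
    then show ?thesis
      using \<phi>h \<psi>h A\<psi>h
      by (simp add: matrix_vector_mult_diff_rdistrib vcoeff_diff vcoeff_matrix_mult flip: matrix_vector_mul_assoc)
  qed
  have "AE z in circle_measure. A *v ?Q z = coproj_vec (\<lambda>z. ctransp (\<phi> z) *v h z) z"
    using AQ coproj_vec_L2_vec[OF \<phi>h]
    by (subst L2_vec_AE_eq_iff)
       (auto simp: vcoeff_matrix_mult Q vcoeff_coproj_vec[OF \<psi>h] vcoeff_coproj_vec[OF \<phi>h] neg)
  then have "vcoeff (\<lambda>z. \<psi> z *v (A *v ?Q z)) k
      = vcoeff (\<lambda>z. \<psi> z *v coproj_vec (\<lambda>z. ctransp (\<phi> z) *v h z) z) k"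
    by (intro vcoeff_cong_AE L2_vec_mult \<psi> AQ coproj_vec_L2_vec \<phi>h) auto
  with 1 show ?thesis by simp
qed

text \<open>A bounded symbol is determined by its Toeplitz operator, negative coefficients
  included.\<close>

lemma vcoeff_mult_eq_iff:
  fixes F G :: "complex \<Rightarrow> complex ^ 'n ^ 'n"
  assumes F: "F \<in> Linfty_mat" and G: "G \<in> Linfty_mat"
  shows "(\<forall>h\<in>H2_vec. \<forall>k\<ge>0. vcoeff (\<lambda>z. F z *v h z) k = vcoeff (\<lambda>z. G z *v h z) k) \<longleftrightarrow>
    (AE z in circle_measure. F z = G z)"
proof
  assume *: "\<forall>h\<in>H2_vec. \<forall>k\<ge>0. vcoeff (\<lambda>z. F z *v h z) k = vcoeff (\<lambda>z. G z *v h z) k"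
  have "mcoeff F k = mcoeff G k" for k
  proof (rule matrix_eqI_mult_vec)
    fix v :: "complex ^ 'n"
    \<comment> \<open>The power of \<open>z\<close> moves index \<open>k\<close> to
      \<open>k + \<bar>k\<bar>\<close>, which is nonnegative and so visible after
      projection.\<close>
    have "vcoeff (\<lambda>z. F z *v (z powi \<bar>k\<bar> *s v)) (k + \<bar>k\<bar>)
        = vcoeff (\<lambda>z. G z *v (z powi \<bar>k\<bar> *s v)) (k + \<bar>k\<bar>)"
      using *[rule_format, OF H2_vec_monomial[of "\<bar>k\<bar>" v], of "k + \<bar>k\<bar>"] by simp
    then show "mcoeff F k *v v = mcoeff G k *v v"
      by (simp add: vector_scalar_commute vcoeff_shift vcoeff_mult_const F G)
  qed
  then show "AE z in circle_measure. F z = G z" by (simp add: Linfty_mat_AE_eq_iff F G)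
next
  assume AE: "AE z in circle_measure. F z = G z"
  have "vcoeff (\<lambda>z. F z *v h z) k = vcoeff (\<lambda>z. G z *v h z) k" if "h \<in> H2_vec" for h k
    using AE by (intro vcoeff_cong_AE L2_vec_mult F G H2_vec_L2_vec that) auto
  then show "\<forall>h\<in>H2_vec. \<forall>k\<ge>0. vcoeff (\<lambda>z. F z *v h z) k = vcoeff (\<lambda>z. G z *v h z) k" by blast
qed

theorem theorem2p13:
  fixes \<phi> \<psi> :: "complex \<Rightarrow> complex ^ 'n ^ 'n"
  assumes "\<phi> \<in> Linfty_mat" and "\<psi> \<in> Linfty_mat"
    and "regular (proj_mat (\<lambda>z. map_matrix (\<lambda>a. cnj z * a) (\<psi> z)))"
    and "regular (proj_mat (\<lambda>z. map_matrix (\<lambda>a. cnj z * a) (ctransp (\<psi> z))))"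
  shows "H2_op_eq (toeplitz \<phi> \<circ> toeplitz \<psi>) (toeplitz \<psi> \<circ> op_adjoint (toeplitz \<phi>)) \<longleftrightarrow>
    (\<exists>A :: complex ^ 'n ^ 'n.
        coanalytic (\<lambda>z. \<phi> z - \<psi> z ** A) \<and>
        coanalytic (\<lambda>z. \<phi> z - ctransp (\<psi> z) ** ctransp A) \<and>
        (AE z in circle_measure. \<phi> z ** \<psi> z = \<psi> z ** ctransp (\<phi> z)))"
proof -
  note \<phi> = assms(1) and \<psi> = assms(2)
  have \<phi>': "(\<lambda>z. ctransp (\<phi> z)) \<in> Linfty_mat" and \<psi>': "(\<lambda>z. ctransp (\<psi> z)) \<in> Linfty_mat"
    by (auto intro: Linfty_mat_ctransp \<phi> \<psi>)
  have \<phi>\<psi>: "(\<lambda>z. \<phi> z ** \<psi> z) \<in> Linfty_mat" and \<psi>\<phi>: "(\<lambda>z. \<psi> z ** ctransp (\<phi> z)) \<in> Linfty_mat"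
    by (auto intro: Linfty_mat_mult \<phi> \<psi> \<phi>')
  let ?op = "\<forall>h\<in>H2_vec. \<forall>k\<ge>0. vcoeff (toeplitz \<phi> (toeplitz \<psi> h)) k
      = vcoeff (toeplitz \<psi> (toeplitz (\<lambda>z. ctransp (\<phi> z)) h)) k"
  have i: "coanalytic (\<lambda>z. \<phi> z - \<psi> z ** A) \<longleftrightarrow> (\<forall>k>0. mcoeff \<phi> k = mcoeff \<psi> k ** A)" for A
    by (simp add: coanalytic_iff Linfty_mat_diff Linfty_mat_mult mcoeff_diff mcoeff_mult_const \<phi> \<psi>)
  have ii: "coanalytic (\<lambda>z. \<phi> z - ctransp (\<psi> z) ** ctransp A) \<longleftrightarrow>
      (\<forall>k>0. ctransp (mcoeff \<phi> k) = A ** mcoeff \<psi> (- k))" for A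
  proof -
    have "coanalytic (\<lambda>z. \<phi> z - ctransp (\<psi> z) ** ctransp A) \<longleftrightarrow>
      (\<forall>k>0. mcoeff \<phi> k = ctransp (A ** mcoeff \<psi> (- k)))"
      by (simp add: coanalytic_iff Linfty_mat_diff Linfty_mat_mult mcoeff_diff mcoeff_mult_const mcoeff_ctransp
          ctransp_mult \<phi> \<psi>')
    moreover have "X = ctransp Y \<longleftrightarrow> ctransp X = Y" for X Y :: "complex ^ 'n ^ 'n"
      using ctransp_ctransp by metis
    ultimately show ?thesis by simp
  qed
  \<comment> \<open>For any \<open>A\<close> satisfying both coefficient conditions, the correction
    terms of the two products agree and cancel, leaving the full symbols. This serves both
    directions of the theorem.\<close>
  have iii: "?op \<longleftrightarrow> (AE z in circle_measure. \<phi> z ** \<psi> z = \<psi> z ** ctransp (\<phi> z))"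
    if "\<forall>k>0. mcoeff \<phi> k = mcoeff \<psi> k ** A" "\<forall>k>0. ctransp (mcoeff \<phi> k) = A ** mcoeff \<psi> (- k)" for A
  proof -
    have "?op \<longleftrightarrow> (\<forall>h\<in>H2_vec. \<forall>k\<ge>0. vcoeff (\<lambda>z. (\<phi> z ** \<psi> z) *v h z) k
        = vcoeff (\<lambda>z. (\<psi> z ** ctransp (\<phi> z)) *v h z) k)"
      using that
      by (intro ball_cong refl all_cong)
         (simp add: vcoeff_toeplitz_toeplitz \<phi> \<psi> \<phi>' vcoeff_coproj_exchange[OF \<phi> \<psi>, of A] flip: matrix_vector_mul_assoc)
    then show ?thesis by (simp only: vcoeff_mult_eq_iff[OF \<phi>\<psi> \<psi>\<phi>])
  qed
  have "\<exists>A. (\<forall>k>0. mcoeff \<phi> k = mcoeff \<psi> k ** A) \<and> (\<forall>k>0. ctransp (mcoeff \<phi> k) = A ** mcoeff \<psi> (- k))"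
    if op: ?op
  proof -
    obtain A where "\<And>k. k \<in> {0<..} \<Longrightarrow> mcoeff \<phi> k = mcoeff \<psi> k ** A"
      "\<And>k. k \<in> {0<..} \<Longrightarrow> ctransp (mcoeff \<phi> k) = A ** mcoeff \<psi> (- k)"
    \<comment> \<open>Here \<open>a\<close> and \<open>b\<close> are the positive coefficients of
      \<open>\<phi>\<close> and \<open>\<psi>\<close>, \<open>c\<close> the adjoints of the former,
      and \<open>d\<close> the negative coefficients of \<open>\<psi>\<close>.\<close>
    proof (rule common_factor_matrix)
      show "mcoeff \<phi> i ** mcoeff \<psi> (- j) = mcoeff \<psi> i ** ctransp (mcoeff \<phi> j)"
        if "i \<in> {0<..}" "j \<in> {0<..}" for i j
        using toeplitz_intertwining_coeffs[OF \<phi> \<psi>] op that by simp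
      show "v = 0" if "\<And>k. k \<in> {0<..} \<Longrightarrow> mcoeff \<psi> k *v v = 0" for v
        using regular_proj_mat_ker[OF \<psi> assms(3)] that by simp
      \<comment> \<open>The positive coefficients of the pointwise adjoint of \<open>\<psi>\<close>
        are the adjoints of its negative ones, so the second regularity hypothesis applies.\<close>
      show "w = 0" if "\<And>k. k \<in> {0<..} \<Longrightarrow> ctransp (mcoeff \<psi> (- k)) *v w = 0" for w
        using regular_proj_mat_ker[OF \<psi>' assms(4)] that by (simp add: mcoeff_ctransp)
    qed blast
    then show ?thesis by auto
  qed
  then show ?thesis unfolding H2_op_eq_iff[OF \<phi> \<psi>] i ii using iii by blast
qed

end
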